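(* Let $$x_1=\Big(\tfrac1{\sqrt6},\tfrac1{\sqrt6},-\tfrac2{\sqrt6}\Big),\qquad x_2=\Big(\tfrac1{\sqrt2},-\tfrac1{\sqrt2},0\Big),$$ let $X_1,X_2,X_3$ be i.i.d. standard exponential random variables, and for real $q$ define $$f(a_1,a_2,a_3):=\mathbb{E}\left|a_1X_1+a_2X_2+a_3X_3\right|^q,$$ subject to the constraints $a_1+a_2+a_3=0$ and $a_1^2+a_2^2+a_3^2=1$ on the real numbers $a_1,a_2,a_3$. Then: (i) for $q\in(-1,0)\cup(2,4)$, $f$ attains its minimum at $x_1$ and its maximum at $x_2$; (ii) for $q\in(0,2)\cup(4,6)$, $f$ is minimized at $x_2$ and maximized at $x_1$; (iii) for $q=k>3$, where $k$ is a non-negative integer, $f$ is minimized at $x_2$ and maximized at $x_1$; (iv) for $q=2$ and $q=4$, $f$ is constant.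
   Context: A standard exponential random variable has density $e^{-x}\mathbf 1_{x>0}$. Minima and maxima are over all $(a_1,a_2,a_3)\in\mathbb{R}^3$ satisfying the two constraints. *)

theory Defs
  imports "HOL-Probability.Probability"
begin

text \<open>
  Powers with real exponent are rendered by \<^const>\<open>powr\<close>. At the base \<open>0\<close> it always returns
  \<open>0\<close>; for the sums considered here the base vanishes only on a null set.
\<close>

definition lin_comb :: "(3 \<Rightarrow> 'w \<Rightarrow> real) \<Rightarrow> real ^ 3 \<Rightarrow> 'w \<Rightarrow> real" where
  "lin_comb X a \<omega> = a $ 1 * X 1 \<omega> + a $ 2 * X 2 \<omega> + a $ 3 * X 3 \<omega>"

definition abs_moment :: "'w measure \<Rightarrow> (3 \<Rightarrow> 'w \<Rightarrow> real) \<Rightarrow> real \<Rightarrow> real ^ 3 \<Rightarrow> real" where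
  "abs_moment M X q a = prob_space.expectation M (\<lambda>\<omega>. \<bar>lin_comb X a \<omega>\<bar> powr q)"

definition feasible :: "(real ^ 3) set" where
  "feasible = {a. a $ 1 + a $ 2 + a $ 3 = 0 \<and> (a $ 1)\<^sup>2 + (a $ 2)\<^sup>2 + (a $ 3)\<^sup>2 = 1}"

definition x1 :: "real ^ 3" where
  "x1 = vector [1 / sqrt 6, 1 / sqrt 6, - (2 / sqrt 6)]"

definition x2 :: "real ^ 3" where
  "x2 = vector [1 / sqrt 2, - (1 / sqrt 2), 0]"

text \<open>\<^const>\<open>is_arg_min\<close> and \<^const>\<open>is_arg_max\<close> also require the point itself to be feasible.\<close>

abbreviation minimized_at :: "(real ^ 3 \<Rightarrow> real) \<Rightarrow> real ^ 3 \<Rightarrow> bool" where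
  "minimized_at f x \<equiv> is_arg_min f (\<lambda>a. a \<in> feasible) x"

abbreviation maximized_at :: "(real ^ 3 \<Rightarrow> real) \<Rightarrow> real ^ 3 \<Rightarrow> bool" where
  "maximized_at f x \<equiv> is_arg_max f (\<lambda>a. a \<in> feasible) x"

end

theory Submission
  imports Defs
begin

text \<open>
  Put \<open>Y = a\<^sub>1 X\<^sub>1 + a\<^sub>2 X\<^sub>2 + a\<^sub>3 X\<^sub>3\<close> and \<open>p = a\<^sub>1 a\<^sub>2 a\<^sub>3\<close>.  The two constraints fix the first two
  elementary symmetric functions of the coefficients, so the law of \<open>Y\<close> depends on \<open>p\<close> alone: its
  characteristic function is
  \<open>\<Prod>\<^sub>j 1 / (1 - \<i> a\<^sub>j s) = 1 / (1 + s\<^sup>2 / 2 + \<i> p s\<^sup>3)\<close>.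
  Passing from \<open>a\<close> to \<open>-a\<close> preserves \<open>\<bar>Y\<bar>\<close>, so absolute moments are functions of \<open>p\<^sup>2\<close>.  A discriminant
  identity gives \<open>0 \<le> p\<^sup>2 \<le> 1/54\<close>, with \<open>p\<^sup>2 = 0\<close> at \<open>x2\<close> and \<open>p\<^sup>2 = 1/54\<close> at \<open>x1\<close>.  Every optimality
  claim thus follows from the monotonicity of \<open>E \<bar>Y\<bar>\<^sup>q\<close> in \<open>p\<^sup>2\<close>, in one direction or the other.

  For fractional \<open>q\<close> the source of monotonicity is the real part of the characteristic function, which
  decreases in \<open>p\<^sup>2\<close> at every point.  Evaluating it at \<open>\<surd>t W\<close> for an independent standard exponential
  \<open>W\<close> and averaging turns the cosine into a Cauchy kernel: \<open>E (1 / (1 + t Y\<^sup>2))\<close> decreases in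
  \<open>p\<^sup>2\<close> (\<open>expectation_cauchy_antimono\<close>).  Division with remainder gives
  \<open>y\<^sup>m\<^sup>+\<^sup>1 / (1 + t y) = (y\<^sup>m - y\<^sup>m / (1 + t y)) / t\<close>, and \<open>E Y\<^sup>2\<close> and \<open>E Y\<^sup>4\<close> are constants, so the
  direction of monotonicity of \<open>E (Y\<^sup>2\<^sup>m / (1 + t Y\<^sup>2))\<close> alternates with \<open>m\<close> up to \<open>m = 3\<close>; the next
  step would need \<open>E Y\<^sup>6\<close>, which varies with \<open>p\<close>.  Integrating against \<open>t\<^sup>\<kappa>\<^sup>-\<^sup>1 dt\<close> for \<open>0 < \<kappa> < 1\<close> reproduces a
  positive multiple of \<open>E \<bar>Y\<bar>\<^sup>2\<^sup>m\<^sup>-\<^sup>2\<^sup>\<kappa>\<close>, and \<open>m = 0, 1, 2, 3\<close> yields the four ranges of \<open>q\<close>, of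
  alternating direction (\<open>abs_moment_mono\<close>).

  For integer exponents, the numbers \<open>E Y\<^sup>k / k!\<close> have generating function \<open>1 / (1 - z\<^sup>2 / 2 - p z\<^sup>3)\<close>.
  They satisfy a recurrence with nonnegative coefficients when \<open>p \<ge> 0\<close>, which settles even \<open>k\<close> and
  shows that \<open>E Y\<^sup>2\<close> and \<open>E Y\<^sup>4\<close> are constant.  For odd \<open>k\<close>, \<open>\<bar>Y\<bar>\<^sup>k = 2 (Y\<^sub>+)\<^sup>k - Y\<^sup>k\<close>.  If \<open>p \<ge> 0\<close>, exactly one
  coefficient \<open>c\<close> is positive, and memorylessness gives \<open>E (Y\<^sub>+)\<^sup>k\<close> in closed form in terms of \<open>c\<close>.  The
  resulting sequence \<open>E (sgn Y \<cdot> Y\<^sup>k) / k!\<close> obeys the same recurrence, and from \<open>k = 4\<close> on it is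
  nonnegative and increasing in \<open>c\<close>: the terms \<open>k = 4, 6\<close> are explicit rational functions of \<open>c\<^sup>2\<close>, the
  term \<open>k = 5\<close> is covered by the fractional case, and the recurrence does the rest
  (\<open>signed_seq_mono\<close>, \<open>abs_moment_nat_mono\<close>).
\<close>

section \<open>The exponential distribution\<close>

text \<open>
  The antiderivative \<open>exp ((z - 1) x) / (z - 1)\<close> vanishes at infinity because \<open>Re z < 1\<close>.  Keeping
  \<open>z\<close> complex yields at once the characteristic function and the exponential moments.
\<close>

lemma exponential_transform_complex:
  fixes z :: complex
  assumes z: "Re z < 1"
  shows "has_bochner_integral lborel
    (\<lambda>x. exponential_density 1 x *\<^sub>R exp (z * of_real x)) (1 / (1 - z))"
proof -
  let ?f = "\<lambda>x::real. exp ((z - 1) * of_real x)"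
  have z1: "z \<noteq> 1" using z by auto
  have eq: "(exponential_density 1 x *\<^sub>R exp (z * of_real x) :: complex) = indicator {0..} x *\<^sub>R ?f x" for x
    by (auto simp: exponential_density_def indicator_def scaleR_conv_of_real exp_of_real[symmetric]
        exp_add[symmetric] algebra_simps simp flip: exp_minus)
  have "integrable lborel (\<lambda>x. exponential_density (1 - Re z) x)"
    using z nn_integral_erlang_ith_moment[of "1 - Re z" 0 0]
    by (intro integrableI_nn_integral_finite[where x = 1]) auto
  then have "integrable lborel (\<lambda>x. exponential_density (1 - Re z) x / (1 - Re z))"
    by (rule integrable_divide_zero)
  \<comment> \<open>The norm of the integrand is, up to a constant, again an exponential density.\<close>
  also have "(\<lambda>x. exponential_density (1 - Re z) x / (1 - Re z))
    = (\<lambda>x. norm (indicator {0..} x *\<^sub>R ?f x))"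
  proof
    fix x :: real
    have "Re ((z - 1) * of_real x) = - ((1 - Re z) * x)" by (simp add: algebra_simps)
    then show "exponential_density (1 - Re z) x / (1 - Re z) = norm (indicator {0..} x *\<^sub>R ?f x)"
      using z by (simp only: norm_scaleR norm_exp_eq_Re) (simp add: exponential_density_def indicator_def)
  qed
  finally have int: "integrable lborel (\<lambda>x. indicator {0..} x *\<^sub>R ?f x)"
    by (rule integrable_norm_cancel) simp
  have lim: "((\<lambda>x::real. ?f x / (z - 1)) \<longlongrightarrow> 0) at_top"
  proof (rule tendsto_norm_zero_cancel)
    have "filterlim (\<lambda>x. (1 - Re z) * x) at_top at_top"
      by (rule filterlim_tendsto_pos_mult_at_top[OF tendsto_const]) (use z in \<open>auto intro: filterlim_ident\<close>)
    then have "((\<lambda>x. exp (- ((1 - Re z) * x))) \<longlongrightarrow> 0) at_top"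
      by (intro filterlim_compose[OF exp_at_bot] filterlim_uminus_at_bot_at_top[THEN filterlim_compose])
    from tendsto_divide_zero[OF this, of "norm (z - 1)"] show "((\<lambda>x::real. norm (?f x / (z - 1))) \<longlongrightarrow> 0) at_top"
      by (simp only: norm_divide norm_exp_eq_Re) (simp add: algebra_simps)
  qed
  have "(LBINT x=0..\<infinity>. ?f x) = 0 - 1 / (z - 1)"
  proof (rule interval_integral_FTC_integrable[where F = "\<lambda>x. ?f x / (z - 1)"])
    show "((\<lambda>x. ?f x / (z - 1)) has_vector_derivative ?f x) (at x)" for x
      by (rule has_vector_derivative_real_field) (use z1 in \<open>auto intro!: derivative_eq_intros\<close>)
    show "set_integrable lborel (einterval 0 \<infinity>) ?f"
      unfolding set_integrable_def
      by (rule Bochner_Integration.integrable_bound[OF int])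
         (auto simp: indicator_def einterval_def zero_ereal_def)
    have "((\<lambda>x. ?f x / (z - 1)) \<longlongrightarrow> ?f 0 / (z - 1)) (at_right 0)"
      by (intro tendsto_intros) (use z1 in auto)
    then show "(((\<lambda>x. ?f x / (z - 1)) \<circ> real_of_ereal) \<longlongrightarrow> 1 / (z - 1)) (at_right 0)"
      by (simp add: ereal_tendsto_simps zero_ereal_def)
    show "(((\<lambda>x. ?f x / (z - 1)) \<circ> real_of_ereal) \<longlongrightarrow> 0) (at_left \<infinity>)"
      using lim by (simp add: ereal_tendsto_simps)
  qed auto
  also have "(LBINT x=0..\<infinity>. ?f x) = (\<integral>x. indicator {0..} x *\<^sub>R ?f x \<partial>lborel)"
  proof -
    have "AE x::real in lborel. x \<noteq> 0" by (rule AE_lborel_singleton)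
    then show ?thesis
      unfolding interval_lebesgue_integral_def set_lebesgue_integral_def
      by (auto intro!: integral_cong_AE simp: einterval_def indicator_def zero_ereal_def)
  qed
  also have "0 - 1 / (z - 1) = 1 / (1 - z)"
    using z1 by (simp add: divide_simps)
  finally show ?thesis
    using int by (simp add: has_bochner_integral_iff eq)
qed

lemma (in prob_space) exponential_transform:
  fixes z :: complex
  assumes Z: "distributed M lborel Z (exponential_density 1)" and z: "Re z < 1"
  shows "has_bochner_integral M (\<lambda>\<omega>. exp (z * of_real (Z \<omega>))) (1 / (1 - z))"
proof -
  have "has_bochner_integral (distr M lborel Z) (\<lambda>x. exp (z * of_real x)) (1 / (1 - z))"
    unfolding distributed_distr_eq_density[OF Z]
    by (rule has_bochner_integral_density) (auto intro: exponential_transform_complex z)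
  then show ?thesis
    using distributed_measurable[OF Z] by (simp add: has_bochner_integral_iff integrable_distr_eq integral_distr)
qed

lemma (in prob_space) exponential_transform_real:
  fixes r :: real
  assumes Z: "distributed M lborel Z (exponential_density 1)" and r: "r < 1"
  shows "has_bochner_integral M (\<lambda>\<omega>. exp (r * Z \<omega>)) (1 / (1 - r))"
proof -
  have "(1::complex) / (1 - of_real r) = of_real (1 / (1 - r))" by simp
  then have "Re (1 / (1 - of_real r)) = 1 / (1 - r)" by (metis Re_complex_of_real)
  then show ?thesis
    using has_bochner_integral_Re[OF exponential_transform[OF Z, of "of_real r"]] r
    by (simp add: Re_exp)
qed

text \<open>
  This is how an exponential average of cosines becomes a Cauchy kernel.
\<close>

lemma exponential_cos_transform:
  "(\<integral>w. cos (s * w) \<partial>density lborel (exponential_density 1)) = 1 / (1 + s\<^sup>2)"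
proof -
  have "has_bochner_integral lborel
    (\<lambda>x. Re (exponential_density 1 x *\<^sub>R exp (\<i> * s * of_real x))) (Re (1 / (1 - \<i> * s)))"
    by (intro has_bochner_integral_Re exponential_transform_complex) simp
  also have "(\<lambda>x. Re (exponential_density 1 x *\<^sub>R exp (\<i> * s * of_real x)))
     = (\<lambda>x. exponential_density 1 x *\<^sub>R cos (s * x))"
    by (simp add: Re_exp)
  also have "Re (1 / (1 - \<i> * s)) = 1 / (1 + s\<^sup>2)"
    by (simp add: Re_divide)
  finally show ?thesis
    by (subst integral_density) (auto simp: has_bochner_integral_iff)
qed

text \<open>
  Memorylessness: the part of \<open>c W + z\<close> above \<open>0\<close> is a copy of \<open>c W\<close>, present with probability
  \<open>exp (z / c)\<close>.  In the proof this is the substitution \<open>x = u - z / c\<close>.  For \<open>k = 0\<close> the formula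
  fails because \<open>0\<^sup>0 = 1\<close>.
\<close>

lemma nn_integral_exponential_positive_part:
  fixes c z :: real
  assumes c: "0 < c" and z: "z \<le> 0" and k: "0 < k"
  shows "(\<integral>\<^sup>+x. ennreal (max 0 (c * x + z) ^ k) \<partial>density lborel (exponential_density 1))
    = ennreal (fact k * c ^ k * exp (z / c))"
proof -
  have "(\<integral>\<^sup>+x. ennreal (max 0 (c * x + z) ^ k) \<partial>density lborel (exponential_density 1))
    = (\<integral>\<^sup>+x. ennreal (exponential_density 1 x) * ennreal (max 0 (c * x + z) ^ k) \<partial>lborel)"
    by (rule nn_integral_density) auto
  also have "\<dots> = ennreal \<bar>1\<bar> * (\<integral>\<^sup>+u. ennreal (exponential_density 1 (- (z / c) + 1 * u))
        * ennreal (max 0 (c * (- (z / c) + 1 * u) + z) ^ k) \<partial>lborel)"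
    by (rule nn_integral_real_affine) auto
  also have "\<dots> = (\<integral>\<^sup>+u. ennreal (c ^ k * exp (z / c)) * (ennreal (u ^ k * exp (- u)) * indicator {0..} u) \<partial>lborel)"
  proof -
    have "ennreal (exponential_density 1 (- (z / c) + 1 * u)) * ennreal (max 0 (c * (- (z / c) + 1 * u) + z) ^ k)
      = ennreal (c ^ k * exp (z / c)) * (ennreal (u ^ k * exp (- u)) * indicator {0..} u)" for u
    proof (cases "0 \<le> u")
      case True
      have zc: "z / c \<le> 0" using c z by (simp add: divide_nonpos_pos)
      have "max 0 (c * (- (z / c) + 1 * u) + z) = c * u"
        using c True by (simp add: algebra_simps)
      moreover have "exponential_density 1 (- (z / c) + 1 * u) = exp (z / c) * exp (- u)"
        using zc True by (simp add: exponential_density_def flip: exp_add)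
      ultimately show ?thesis
        using c True by (simp add: power_mult_distrib ennreal_mult'[symmetric] mult_ac)
    next
      case False
      have "max 0 (c * (- (z / c) + 1 * u) + z) = 0"
        using c False by (simp add: algebra_simps mult_le_0_iff)
      then show ?thesis using k False by simp
    qed
    then show ?thesis by simp
  qed
  also have "\<dots> = ennreal (c ^ k * exp (z / c)) * ennreal (fact k)"
    by (subst nn_integral_cmult) (auto simp: nn_intergal_power_times_exp_Ici)
  also have "\<dots> = ennreal (fact k * c ^ k * exp (z / c))"
    using c by (simp add: ennreal_mult'[symmetric] mult_ac)
  finally show ?thesis .
qed

lemma nn_integral_exponential_powr_finite:
  assumes "- 1 < q"
  shows "(\<integral>\<^sup>+w. ennreal (w powr q) \<partial>density lborel (exponential_density 1)) < \<infinity>"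
proof -
  have "(\<integral>\<^sup>+w. ennreal (w powr q) \<partial>density lborel (exponential_density 1))
    = (\<integral>\<^sup>+w. ennreal (indicator {0..} w * (w powr (q + 1 - 1) / exp w)) \<partial>lborel)"
    by (subst nn_integral_density)
       (auto intro!: nn_integral_cong simp: exponential_density_def indicator_def exp_minus field_simps simp flip: ennreal_mult)
  also have "\<dots> = ennreal (Gamma (q + 1))"
    by (rule nn_integral_has_integral_lebesgue[OF _ Gamma_integral_real]) (use assms in auto)
  finally show ?thesis by simp
qed

text \<open>
  The binomial theorem, with \<open>E Z\<^sup>j = j!\<close> cancelling the factorials.  In normalised form the right-hand
  side is a Cauchy product, which is what makes generating functions the right tool below.
\<close>

lemma (in prob_space) exponential_shift_moment:
  assumes ind: "indep_var borel (\<lambda>\<omega>. c * Z \<omega>) borel S"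
    and Z: "distributed M lborel Z (exponential_density 1)"
    and S: "\<And>k. integrable M (\<lambda>\<omega>. S \<omega> ^ k)"
  shows "integrable M (\<lambda>\<omega>. (c * Z \<omega> + S \<omega>) ^ k)"
    and "expectation (\<lambda>\<omega>. (c * Z \<omega> + S \<omega>) ^ k) / fact k
      = (\<Sum>j\<le>k. c ^ j * (expectation (\<lambda>\<omega>. S \<omega> ^ (k - j)) / fact (k - j)))"
proof -
  have Zj: "integrable M (\<lambda>\<omega>. (c * Z \<omega>) ^ j)" "expectation (\<lambda>\<omega>. (c * Z \<omega>) ^ j) = c ^ j * fact j" for j
    using erlang_ith_moment_integrable[OF _ Z, of j] erlang_ith_moment[OF _ Z, of j]
    by (auto simp: power_mult_distrib)
  have ind': "indep_var borel (\<lambda>\<omega>. (c * Z \<omega>) ^ j) borel (\<lambda>\<omega>. S \<omega> ^ l)" for j l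
    using indep_var_compose[OF ind, of "\<lambda>x. x ^ j" borel "\<lambda>x. x ^ l" borel] by (simp add: comp_def)
  have int: "integrable M (\<lambda>\<omega>. (c * Z \<omega>) ^ j * S \<omega> ^ l)" for j l
    by (rule indep_var_integrable[OF ind' Zj(1) S])
  have binom: "(c * Z \<omega> + S \<omega>) ^ k = (\<Sum>j\<le>k. real (k choose j) * ((c * Z \<omega>) ^ j * S \<omega> ^ (k - j)))" for \<omega>
    by (simp add: binomial_ring mult.assoc)
  show "integrable M (\<lambda>\<omega>. (c * Z \<omega> + S \<omega>) ^ k)"
    unfolding binom by (intro Bochner_Integration.integrable_sum integrable_mult_right int)
  have "expectation (\<lambda>\<omega>. (c * Z \<omega> + S \<omega>) ^ k)
    = (\<Sum>j\<le>k. real (k choose j) * (c ^ j * fact j * expectation (\<lambda>\<omega>. S \<omega> ^ (k - j))))"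
    unfolding binom
    by (subst Bochner_Integration.integral_sum)
       (auto intro!: sum.cong integrable_mult_right int simp: indep_var_lebesgue_integral[OF ind' Zj(1) S] Zj)
  also have "\<dots> / fact k = (\<Sum>j\<le>k. c ^ j * (expectation (\<lambda>\<omega>. S \<omega> ^ (k - j)) / fact (k - j)))"
    unfolding sum_divide_distrib by (intro sum.cong) (auto simp: binomial_fact field_simps)
  finally show "expectation (\<lambda>\<omega>. (c * Z \<omega> + S \<omega>) ^ k) / fact k
      = (\<Sum>j\<le>k. c ^ j * (expectation (\<lambda>\<omega>. S \<omega> ^ (k - j)) / fact (k - j)))" .
qed

section \<open>Powers as integrals of rational functions\<close>

text \<open>
  By scaling, this Stieltjes transform of \<open>t\<^sup>\<kappa>\<^sup>-\<^sup>1\<close> is a multiple of \<open>y\<^sup>-\<^sup>\<kappa>\<close> with factor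
  \<open>stieltjes \<kappa> 1 = \<pi> / sin (\<pi> \<kappa>)\<close>, positive and finite for \<open>0 < \<kappa> < 1\<close>.
\<close>

definition stieltjes :: "real \<Rightarrow> real \<Rightarrow> ennreal" where
  "stieltjes \<kappa> y = (\<integral>\<^sup>+t. ennreal (t powr (\<kappa> - 1) / (1 + t * y)) * indicator {0<..} t \<partial>lborel)"

lemma stieltjes_finite:
  assumes "0 < \<kappa>" "\<kappa> < 1"
  shows "stieltjes \<kappa> 1 < \<infinity>"
proof -
  have A: "(\<integral>\<^sup>+t. ennreal (indicator {0..1} t * t powr (\<kappa> - 1)) \<partial>lborel) < \<infinity>"
    using nn_integral_has_integral_lebesgue[OF _ has_integral_powr_from_0[of "\<kappa> - 1" 1]] assms
    by simp
  have B: "(\<integral>\<^sup>+t. ennreal (indicator {1..} t * t powr (\<kappa> - 2)) \<partial>lborel) < \<infinity>"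
    using nn_integral_has_integral_lebesgue[OF _ has_integral_powr_to_inf[of "\<kappa> - 2" 1]] assms
    by simp
  have "stieltjes \<kappa> 1 \<le> (\<integral>\<^sup>+t. ennreal (indicator {0..1} t * t powr (\<kappa> - 1))
       + ennreal (indicator {1..} t * t powr (\<kappa> - 2)) \<partial>lborel)"
    unfolding stieltjes_def
  proof (intro nn_integral_mono)
    fix t :: real
    consider "t \<le> 0" | "0 < t" "t \<le> 1" | "1 < t" by linarith
    then show "ennreal (t powr (\<kappa> - 1) / (1 + t * 1)) * indicator {0<..} t
       \<le> ennreal (indicator {0..1} t * t powr (\<kappa> - 1)) + ennreal (indicator {1..} t * t powr (\<kappa> - 2))"
    proof cases
      case 2
      then show ?thesis
        by (auto simp: indicator_def field_simps simp flip: ennreal_plus intro!: ennreal_leI add_increasing2)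
    next
      case 3
      then have "t powr (\<kappa> - 2) = t powr (\<kappa> - 1) / t"
        by (simp add: powr_diff power2_eq_square)
      then show ?thesis using 3
        by (auto simp: indicator_def intro!: ennreal_leI divide_left_mono)
    qed auto
  qed
  also have "\<dots> = (\<integral>\<^sup>+t. ennreal (indicator {0..1} t * t powr (\<kappa> - 1)) \<partial>lborel)
       + (\<integral>\<^sup>+t. ennreal (indicator {1..} t * t powr (\<kappa> - 2)) \<partial>lborel)"
    by (intro nn_integral_add) auto
  also have "\<dots> < \<infinity>" using A B by simp
  finally show ?thesis .
qed

lemma stieltjes_pos: "stieltjes \<kappa> 1 > 0"
proof (rule ccontr)
  assume "\<not> stieltjes \<kappa> 1 > 0"
  then have "AE t in lborel. ennreal (t powr (\<kappa> - 1) / (1 + t * 1)) * indicator {0<..} t = 0"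
    unfolding stieltjes_def not_gr_zero by (subst (asm) nn_integral_0_iff_AE) auto
  then have "AE t in lborel. \<not> (t::real) \<in> {0<..<1}"
    by eventually_elim (auto simp: indicator_def split: if_splits)
  then have "emeasure lborel {0<..<1::real} = 0"
    by (subst (asm) AE_iff_measurable[where N = "{0<..<1}"]) auto
  then show False by simp
qed

lemma stieltjes_scale:
  assumes "0 < y"
  shows "stieltjes \<kappa> y = ennreal (y powr (-\<kappa>)) * stieltjes \<kappa> 1"
proof -
  have eq: "ennreal ((0 + 1 / y * t) powr (\<kappa> - 1) / (1 + (0 + 1 / y * t) * y)) * indicator {0<..} (0 + 1 / y * t)
      = ennreal (y powr (1 - \<kappa>)) * (ennreal (t powr (\<kappa> - 1) / (1 + t * 1)) * indicator {0<..} t)" for t :: real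
  proof (cases "0 < t")
    case True
    have "(1 / y * t) powr (\<kappa> - 1) = y powr (1 - \<kappa>) * t powr (\<kappa> - 1)"
      using assms True by (simp add: powr_divide powr_diff field_simps)
    then show ?thesis
      using assms True by (simp flip: ennreal_mult)
  qed (use assms in \<open>auto simp: zero_less_divide_iff\<close>)
  have "stieltjes \<kappa> y = ennreal \<bar>1 / y\<bar> *
      (\<integral>\<^sup>+t. ennreal ((0 + 1 / y * t) powr (\<kappa> - 1) / (1 + (0 + 1 / y * t) * y)) * indicator {0<..} (0 + 1 / y * t) \<partial>lborel)"
    unfolding stieltjes_def by (rule nn_integral_real_affine) (use assms in auto)
  also have "\<dots> = ennreal (1 / y) * (\<integral>\<^sup>+t. ennreal (y powr (1 - \<kappa>)) *
       (ennreal (t powr (\<kappa> - 1) / (1 + t * 1)) * indicator {0<..} t) \<partial>lborel)"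
    unfolding eq using assms by simp
  also have "\<dots> = ennreal (1 / y) * ennreal (y powr (1 - \<kappa>)) * stieltjes \<kappa> 1"
    unfolding stieltjes_def by (subst nn_integral_cmult) (auto simp: mult.assoc)
  also have "ennreal (1 / y) * ennreal (y powr (1 - \<kappa>)) = ennreal (y powr (-\<kappa>))"
    using assms by (simp add: powr_diff powr_minus field_simps flip: ennreal_mult)
  finally show ?thesis .
qed

text \<open>
  Monotonicity in \<open>y\<close> reduces this to \<open>y\<^sup>-\<^sup>\<kappa> \<longlongrightarrow> \<infinity>\<close> as \<open>y\<close> tends to \<open>0\<close>.  The divergence is used
  to show that the linear combination is almost surely nonzero.
\<close>

lemma stieltjes_0:
  assumes "0 < \<kappa>" "\<kappa> < 1"
  shows "stieltjes \<kappa> 0 = \<infinity>"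
proof (rule ccontr)
  assume "stieltjes \<kappa> 0 \<noteq> \<infinity>"
  then obtain r where r: "0 \<le> r" "stieltjes \<kappa> 0 = ennreal r"
    by (cases "stieltjes \<kappa> 0") auto
  obtain c where c: "0 < c" "stieltjes \<kappa> 1 = ennreal c"
    using stieltjes_finite[OF assms] stieltjes_pos[of \<kappa>] by (cases "stieltjes \<kappa> 1") auto
  have le: "y powr (-\<kappa>) * c \<le> r" if "0 < y" for y
  proof -
    have "stieltjes \<kappa> y \<le> stieltjes \<kappa> 0"
      unfolding stieltjes_def
      using that by (intro nn_integral_mono) (auto simp: indicator_def divide_simps mult_le_cancel_left1 intro!: ennreal_leI)
    then show ?thesis
      unfolding stieltjes_scale[OF that] c r
      using c r by (subst (asm) ennreal_mult[symmetric]) auto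
  qed
  \<comment> \<open>chosen so that the scaled value at \<open>y\<close> is \<open>r + 1\<close>, exceeding the supposed bound \<open>r\<close>\<close>
  define y where "y = ((r + 1) / c) powr (- 1 / \<kappa>)"
  have "y powr (-\<kappa>) = (r + 1) / c"
    using assms r c unfolding y_def powr_powr by simp
  moreover have "0 < y" using r c unfolding y_def by simp
  ultimately show False using le[of y] c by simp
qed

lemma stieltjes_measurable [measurable]: "stieltjes \<kappa> \<in> borel_measurable borel"
  unfolding stieltjes_def by measurable

section \<open>The constraint circle\<close>

definition coord_prod :: "real ^ 3 \<Rightarrow> real" where
  "coord_prod a = a $ 1 * a $ 2 * a $ 3"

lemma feasible_pairs:
  assumes "a \<in> feasible"
  shows "a $ 1 * a $ 2 + a $ 1 * a $ 3 + a $ 2 * a $ 3 = - 1 / 2"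
proof -
  have "(a $ 1 + a $ 2 + a $ 3)\<^sup>2 = 0" "(a $ 1)\<^sup>2 + (a $ 2)\<^sup>2 + (a $ 3)\<^sup>2 = 1"
    using assms by (auto simp: feasible_def)
  then show ?thesis by (simp add: power2_eq_square algebra_simps)
qed

text \<open>
  Used twice: over the complex numbers for the characteristic function and over formal power series
  for the moments.
\<close>

lemma cubic_reciprocal:
  fixes x y w z h :: "'a :: comm_ring_1"
  assumes "x + y + w = 0" "x * y + x * w + y * w = - h"
  shows "(1 - x * z) * (1 - y * z) * (1 - w * z) = 1 - h * z\<^sup>2 - (x * y * w) * z ^ 3"
proof -
  have "(1 - x * z) * (1 - y * z) * (1 - w * z)
    = 1 - (x + y + w) * z + (x * y + x * w + y * w) * z\<^sup>2 - (x * y * w) * z ^ 3"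
    by (simp add: algebra_simps power2_eq_square power3_eq_cube)
  then show ?thesis unfolding assms by simp
qed

text \<open>
  The coordinates are the roots of \<open>x\<^sup>3 - x / 2 - p\<close>, and the discriminant \<open>1/2 - 27 p\<^sup>2\<close> of this cubic
  is the square of the product of the root differences.
\<close>

lemma coord_prod_sq_le:
  assumes a: "a \<in> feasible"
  shows "(coord_prod a)\<^sup>2 \<le> 1 / 54"
proof -
  have s: "a $ 3 = - a $ 1 - a $ 2" using a by (simp add: feasible_def)
  have q: "(a $ 1)\<^sup>2 + a $ 1 * a $ 2 + (a $ 2)\<^sup>2 = 1 / 2"
    using feasible_pairs[OF a] unfolding s by (simp add: power2_eq_square algebra_simps)
  \<comment> \<open>the three root differences, after eliminating \<open>a $ 3\<close>\<close>
  have "0 \<le> ((a $ 1 - a $ 2) * (2 * a $ 1 + a $ 2) * (a $ 1 + 2 * a $ 2))\<^sup>2" by simp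
  also have "\<dots> = 4 * ((a $ 1)\<^sup>2 + a $ 1 * a $ 2 + (a $ 2)\<^sup>2) ^ 3 - 27 * (coord_prod a)\<^sup>2"
    unfolding coord_prod_def s by algebra
  finally show ?thesis unfolding q by (simp add: power3_eq_cube)
qed

lemma x1_feasible: "x1 \<in> feasible" and x2_feasible: "x2 \<in> feasible"
  by (simp_all add: feasible_def x1_def x2_def power_divide)

lemma coord_prod_x1: "coord_prod x1 = - (1 / (3 * sqrt 6))"
  by (simp add: coord_prod_def x1_def)

lemma coord_prod_x2: "coord_prod x2 = 0"
  by (simp add: coord_prod_def x2_def)

text \<open>
  The coordinates are the roots of \<open>x\<^sup>3 - x / 2 - p\<close>.  For a positive root \<open>c = a $ i\<close>, clearing
  fractions turns the product into \<open>c\<^sup>2\<close> over the product of \<open>c - a $ j\<close>, which is the derivative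
  \<open>3 c\<^sup>2 - 1/2\<close> of that cubic at \<open>c\<close>.
\<close>

lemma feasible_root:
  assumes a: "a \<in> feasible"
  shows "a $ i * ((a $ i)\<^sup>2 - 1 / 2) = coord_prod a"
    and "0 < a $ i \<Longrightarrow> (\<Prod>j\<in>UNIV - {i}. 1 / (1 - a $ j / a $ i)) = (a $ i)\<^sup>2 / (3 * (a $ i)\<^sup>2 - 1 / 2)"
proof -
  have root: "c * (c\<^sup>2 - 1 / 2) = c * x * y"
    and prod: "0 < c \<Longrightarrow> 1 / (1 - x / c) * (1 / (1 - y / c)) = c\<^sup>2 / (3 * c\<^sup>2 - 1 / 2)"
    if s: "c + x + y = 0" and e: "c * x + c * y + x * y = - 1 / 2" for c x y :: real
  proof -
    have y: "y = - c - x" using s by simp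
    have xy: "x * y = c\<^sup>2 - 1 / 2" using e unfolding y by (simp add: algebra_simps power2_eq_square)
    then show "c * (c\<^sup>2 - 1 / 2) = c * x * y" by simp
    have "(c - x) * (c - y) = 3 * c\<^sup>2 - 1 / 2"
      using e unfolding y by (simp add: algebra_simps power2_eq_square)
    moreover have "1 / (1 - x / c) * (1 / (1 - y / c)) = c\<^sup>2 / ((c - x) * (c - y))" if "0 < c"
    proof -
      have "1 - x / c = (c - x) / c" "1 - y / c = (c - y) / c"
        using that by (simp_all add: diff_divide_distrib)
      then show ?thesis by (simp add: power2_eq_square)
    qed
    ultimately show "1 / (1 - x / c) * (1 / (1 - y / c)) = c\<^sup>2 / (3 * c\<^sup>2 - 1 / 2)" if "0 < c"
      using that by simp
  qed
  have s: "a $ 1 + a $ 2 + a $ 3 = 0" using a by (simp add: feasible_def)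
  note e = feasible_pairs[OF a]
  have I: "UNIV - {1} = {2, 3 :: 3}" "UNIV - {2} = {1, 3 :: 3}" "UNIV - {3} = {1, 2 :: 3}"
    unfolding UNIV_3 by auto
  consider "i = 1" | "i = 2" | "i = 3" using exhaust_3 by blast
  then have "\<exists>x y. a $ i + x + y = 0 \<and> a $ i * x + a $ i * y + x * y = - 1 / 2 \<and> coord_prod a = a $ i * x * y
     \<and> (\<Prod>j\<in>UNIV - {i}. 1 / (1 - a $ j / a $ i)) = 1 / (1 - x / a $ i) * (1 / (1 - y / a $ i))"
  proof cases
    case 1
    then show ?thesis using s e
      by (intro exI[of _ "a $ 2"] exI[of _ "a $ 3"]) (simp add: I coord_prod_def algebra_simps)
  next
    case 2
    then show ?thesis using s e
      by (intro exI[of _ "a $ 1"] exI[of _ "a $ 3"]) (simp add: I coord_prod_def algebra_simps)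
  next
    case 3
    then show ?thesis using s e
      by (intro exI[of _ "a $ 1"] exI[of _ "a $ 2"]) (simp add: I coord_prod_def algebra_simps)
  qed
  then obtain x y where xy: "a $ i + x + y = 0" "a $ i * x + a $ i * y + x * y = - 1 / 2"
    "coord_prod a = a $ i * x * y"
    "(\<Prod>j\<in>UNIV - {i}. 1 / (1 - a $ j / a $ i)) = 1 / (1 - x / a $ i) * (1 / (1 - y / a $ i))"
    by blast
  show "a $ i * ((a $ i)\<^sup>2 - 1 / 2) = coord_prod a"
    using root[OF xy(1,2)] xy(3) by simp
  show "(\<Prod>j\<in>UNIV - {i}. 1 / (1 - a $ j / a $ i)) = (a $ i)\<^sup>2 / (3 * (a $ i)\<^sup>2 - 1 / 2)" if "0 < a $ i"
    using prod[OF xy(1,2) that] xy(4) by simp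
qed

text \<open>
  The coordinates sum to zero and do not all vanish, so a sign pattern with two positive entries has a
  negative third one and a negative product.
\<close>

lemma feasible_single_positive:
  assumes a: "a \<in> feasible" and p: "0 \<le> coord_prod a"
  shows "\<exists>i. 0 < a $ i \<and> (\<forall>j. j \<noteq> i \<longrightarrow> a $ j \<le> 0)"
proof -
  have s: "a $ 3 = - a $ 1 - a $ 2" and n: "(a $ 1)\<^sup>2 + (a $ 2)\<^sup>2 + (a $ 3)\<^sup>2 = 1"
    using a by (auto simp: feasible_def)
  consider "0 < a $ 1" "a $ 2 \<le> 0" "a $ 3 \<le> 0" | "a $ 1 \<le> 0" "0 < a $ 2" "a $ 3 \<le> 0"
    | "a $ 1 \<le> 0" "a $ 2 \<le> 0" "0 < a $ 3" | "a $ 1 = 0" "a $ 2 = 0" "a $ 3 = 0"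
    | "0 < a $ 1" "0 < a $ 2" "a $ 3 < 0" | "0 < a $ 1" "a $ 2 < 0" "0 < a $ 3"
    | "a $ 1 < 0" "0 < a $ 2" "0 < a $ 3"
    using s by linarith
  then show ?thesis
  proof cases
    case 1
    then show ?thesis by (intro exI[of _ 1]) (auto simp: forall_3)
  next
    case 2
    then show ?thesis by (intro exI[of _ 2]) (auto simp: forall_3)
  next
    case 3
    then show ?thesis by (intro exI[of _ 3]) (auto simp: forall_3)
  next
    case 4
    then show ?thesis using n by simp
  next
    case 5
    then have "coord_prod a < 0" unfolding coord_prod_def by (intro mult_pos_neg mult_pos_pos)
    then show ?thesis using p by simp
  next
    case 6
    then have "coord_prod a < 0" unfolding coord_prod_def by (intro mult_neg_pos mult_pos_neg)
    then show ?thesis using p by simp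
  next
    case 7
    then have "coord_prod a < 0" unfolding coord_prod_def by (intro mult_neg_pos)
    then show ?thesis using p by simp
  qed
qed

text \<open>
  The lower bound is \<open>p = c (c\<^sup>2 - 1/2) \<ge> 0\<close>; the upper bound is \<open>(y + z)\<^sup>2 \<le> 2 (y\<^sup>2 + z\<^sup>2)\<close> for the other
  two coordinates.
\<close>

lemma feasible_coord_bounds:
  assumes a: "a \<in> feasible" and p: "0 \<le> coord_prod a" and c: "0 < a $ i"
  shows "1 / 2 \<le> (a $ i)\<^sup>2" "(a $ i)\<^sup>2 \<le> 2 / 3"
proof -
  show "1 / 2 \<le> (a $ i)\<^sup>2"
    using p c unfolding feasible_root(1)[OF a, of i, symmetric] by (simp add: zero_le_mult_iff)
  have "x\<^sup>2 \<le> 2 / 3" if "x + y + z = 0" "x\<^sup>2 + y\<^sup>2 + z\<^sup>2 = 1" for x y z :: real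
  proof -
    have z: "z = - x - y" using that by simp
    have "(x + 2 * y)\<^sup>2 = 2 * (x\<^sup>2 + y\<^sup>2 + z\<^sup>2) - 3 * x\<^sup>2"
      unfolding z by (simp add: power2_eq_square algebra_simps)
    then have "(x + 2 * y)\<^sup>2 = 2 - 3 * x\<^sup>2" unfolding that(2) by simp
    moreover have "0 \<le> (x + 2 * y)\<^sup>2" by simp
    ultimately show ?thesis by linarith
  qed
  from this[of "a $ 1" "a $ 2" "a $ 3"] this[of "a $ 2" "a $ 1" "a $ 3"] this[of "a $ 3" "a $ 1" "a $ 2"]
  show "(a $ i)\<^sup>2 \<le> 2 / 3"
    using a exhaust_3[of i] by (auto simp: feasible_def algebra_simps)
qed

text \<open>
  \<open>x2\<close> and \<open>x1\<close> are the points where \<open>(coord_prod a)\<^sup>2\<close> attains its bounds \<open>0\<close> and \<open>1/54\<close>.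
\<close>

lemma extremal_of_mono:
  assumes "\<And>a b. a \<in> feasible \<Longrightarrow> b \<in> feasible \<Longrightarrow> (coord_prod a)\<^sup>2 \<le> (coord_prod b)\<^sup>2 \<Longrightarrow> f a \<le> f b"
  shows "minimized_at f x2 \<and> maximized_at f x1"
proof -
  have "(coord_prod x1)\<^sup>2 = 1 / 54" by (simp add: coord_prod_x1 power_divide power_mult_distrib)
  then have "f x2 \<le> f a \<and> f a \<le> f x1" if "a \<in> feasible" for a
    using assms[of x2 a] assms[of a x1] coord_prod_sq_le[OF that] that x1_feasible x2_feasible
    by (simp add: coord_prod_x2)
  then show ?thesis
    by (auto simp: is_arg_min_def is_arg_max_def x1_feasible x2_feasible not_less)
qed

lemma extremal_of_antimono:
  assumes "\<And>a b. a \<in> feasible \<Longrightarrow> b \<in> feasible \<Longrightarrow> (coord_prod a)\<^sup>2 \<le> (coord_prod b)\<^sup>2 \<Longrightarrow> f b \<le> f a"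
  shows "minimized_at f x1 \<and> maximized_at f x2"
proof -
  have "minimized_at (\<lambda>a. - f a) x2 \<and> maximized_at (\<lambda>a. - f a) x1"
    by (rule extremal_of_mono) (simp add: assms)
  then show ?thesis by (auto simp: is_arg_min_def is_arg_max_def)
qed

section \<open>The characteristic function and its Cauchy averages\<close>

text \<open>
  The real part of \<open>1 / (1 + s\<^sup>2 / 2 + \<i> p s\<^sup>3)\<close>, as a function of \<open>P = p\<^sup>2\<close>.
\<close>

definition re_char :: "real \<Rightarrow> real \<Rightarrow> real" where
  "re_char P s = (1 + s\<^sup>2 / 2) / ((1 + s\<^sup>2 / 2)\<^sup>2 + P * s ^ 6)"

text \<open>
  All the monotonicity of fractional moments comes from here: \<open>P\<close> occurs only in the denominator.
\<close>

lemma re_char_antimono: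
  assumes "0 \<le> P" "P \<le> Q"
  shows "re_char Q s \<le> re_char P s"
proof -
  have "0 < 1 + s\<^sup>2 / 2" by (simp add: add_pos_nonneg)
  moreover have "0 < (1 + s\<^sup>2 / 2)\<^sup>2 + R * s ^ 6" if "0 \<le> R" for R
    using that \<open>0 < 1 + s\<^sup>2 / 2\<close> by (intro add_pos_nonneg mult_nonneg_nonneg) auto
  ultimately show ?thesis
    unfolding re_char_def using assms
    by (intro divide_left_mono add_left_mono mult_right_mono mult_pos_pos) auto
qed

lemma re_char_nonneg: "0 \<le> P \<Longrightarrow> 0 \<le> re_char P s"
  unfolding re_char_def by (intro divide_nonneg_nonneg add_nonneg_nonneg mult_nonneg_nonneg) auto

lemma re_char_0: "re_char 0 s = 1 / (1 + s\<^sup>2 / 2)"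
  by (simp add: re_char_def power2_eq_square)

lemma re_char_le_1: "0 \<le> P \<Longrightarrow> re_char P s \<le> 1"
  by (rule order_trans[OF re_char_antimono[of 0 P s]]) (simp_all add: re_char_0 divide_le_eq add_pos_nonneg)

lemma Re_iexp: "Re (iexp y) = cos y"
  by (simp add: Re_exp)

lemma re_char_eq: "Re (1 / (1 + of_real (s\<^sup>2 / 2) + \<i> * of_real (p * s ^ 3))) = re_char (p\<^sup>2) s"
proof -
  have "(p * s ^ 3)\<^sup>2 = p\<^sup>2 * s ^ 6" by (simp add: power_mult_distrib flip: power_mult)
  then show ?thesis unfolding Re_divide re_char_def by simp
qed

locale iid_exponential_triple = prob_space M
  for M :: "'w measure" and X :: "3 \<Rightarrow> 'w \<Rightarrow> real" +
  assumes indep: "indep_vars (\<lambda>_. borel) X UNIV"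
    and exponential: "distributed M lborel (X i) (exponential_density 1)"
begin

lemma rv [measurable]: "X i \<in> borel_measurable M"
  using distributed_measurable[OF exponential] by simp

lemma lin_comb_measurable [measurable]: "lin_comb X a \<in> borel_measurable M"
  unfolding lin_comb_def by measurable

lemma lin_comb_eq_sum: "lin_comb X a \<omega> = (\<Sum>i\<in>UNIV. a $ i * X i \<omega>)"
  by (simp add: lin_comb_def sum_3)

lemma char_lin_comb:
  assumes a: "a \<in> feasible"
  shows "has_bochner_integral M (\<lambda>\<omega>. iexp (s * lin_comb X a \<omega>))
    (1 / (1 + of_real (s\<^sup>2 / 2) + \<i> * of_real (coord_prod a * s ^ 3)))"
proof -
  let ?e = "\<lambda>i \<omega>. exp (\<i> * of_real (s * a $ i) * of_real (X i \<omega>))"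
  have "of_real (a $ 1) + of_real (a $ 2) + of_real (a $ 3) = (0 :: complex)"
    using a by (simp add: feasible_def flip: of_real_add)
  moreover have "of_real (a $ 1) * of_real (a $ 2) + of_real (a $ 1) * of_real (a $ 3)
      + of_real (a $ 2) * of_real (a $ 3) = (- of_real (1 / 2) :: complex)"
    unfolding of_real_mult[symmetric] of_real_add[symmetric] feasible_pairs[OF a] by simp
  ultimately have cubic: "(1 - of_real (a $ 1) * (\<i> * s)) * (1 - of_real (a $ 2) * (\<i> * s)) * (1 - of_real (a $ 3) * (\<i> * s))
      = 1 - of_real (1 / 2) * (\<i> * s)\<^sup>2 - of_real (coord_prod a) * (\<i> * s) ^ 3"
    unfolding coord_prod_def of_real_mult by (rule cubic_reciprocal)
  have T: "has_bochner_integral M (?e i) (1 / (1 - \<i> * of_real (s * a $ i)))" for i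
    by (intro exponential_transform exponential) simp
  have I: "indep_vars (\<lambda>_. borel) ?e UNIV"
    by (intro indep_vars_compose2[OF indep, where Y = "\<lambda>i x. exp (\<i> * of_real (s * a $ i) * of_real x)"]) measurable
  have e: "iexp (s * lin_comb X a \<omega>) = (\<Prod>i\<in>UNIV. ?e i \<omega>)" for \<omega>
    by (simp add: lin_comb_eq_sum sum_distrib_left mult.assoc flip: exp_sum)
  have "integrable M (\<lambda>\<omega>. \<Prod>i\<in>UNIV. ?e i \<omega>)"
    by (rule indep_vars_integrable[OF _ I]) (use T in \<open>auto simp: has_bochner_integral_iff\<close>)
  moreover have "(\<integral>\<omega>. (\<Prod>i\<in>UNIV. ?e i \<omega>) \<partial>M) = (\<Prod>i\<in>UNIV. 1 / (1 - \<i> * of_real (s * a $ i)))"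
    using T by (subst indep_vars_lebesgue_integral[OF _ I]) (auto simp: has_bochner_integral_iff)
  moreover have "(\<Prod>i\<in>UNIV. 1 / (1 - \<i> * of_real (s * a $ i)))
     = 1 / ((1 - of_real (a $ 1) * (\<i> * s)) * (1 - of_real (a $ 2) * (\<i> * s)) * (1 - of_real (a $ 3) * (\<i> * s)))"
    unfolding UNIV_3 by (simp add: mult.assoc) (simp only: mult_ac)
  moreover have "\<dots> = 1 / (1 + of_real (s\<^sup>2 / 2) + \<i> * of_real (coord_prod a * s ^ 3))"
    unfolding cubic
    by (simp add: power_mult_distrib power3_eq_cube power2_eq_square mult_ac)
  ultimately show ?thesis
    unfolding e by (simp add: has_bochner_integral_iff)
qed

lemma expectation_cos_lin_comb:
  assumes "a \<in> feasible"
  shows "expectation (\<lambda>\<omega>. cos (s * lin_comb X a \<omega>)) = re_char ((coord_prod a)\<^sup>2) s"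
  using has_bochner_integral_Re[OF char_lin_comb[OF assms, of s]]
  unfolding re_char_eq has_bochner_integral_iff Re_iexp by simp

text \<open>
  Both sides equal the expectation of \<open>cos (\<surd>t Y W)\<close> with \<open>W\<close> an independent standard exponential
  variable, computed by conditioning on \<open>Y\<close> and on \<open>W\<close> respectively.
\<close>

lemma expectation_cauchy:
  assumes a: "a \<in> feasible" and t: "0 \<le> t"
  shows "expectation (\<lambda>\<omega>. 1 / (1 + t * (lin_comb X a \<omega>)\<^sup>2))
    = (\<integral>w. re_char ((coord_prod a)\<^sup>2) (sqrt t * w) \<partial>density lborel (exponential_density 1))"
proof -
  define E where "E = density lborel (exponential_density 1)"
  have sE [measurable_cong]: "sets E = sets borel" by (simp add: E_def)
  interpret E: prob_space E unfolding E_def by (rule prob_space_exponential_density) simp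
  interpret P: pair_prob_space M E ..
  have "integrable (M \<Otimes>\<^sub>M E) (\<lambda>(\<omega>, w). cos (sqrt t * lin_comb X a \<omega> * w))"
    by (rule P.integrable_const_bound[where B = 1]) (auto simp: case_prod_unfold)
  then have "(\<integral>w. (\<integral>\<omega>. cos (sqrt t * lin_comb X a \<omega> * w) \<partial>M) \<partial>E) = (\<integral>\<omega>. (\<integral>w. cos (sqrt t * lin_comb X a \<omega> * w) \<partial>E) \<partial>M)"
    by (rule P.Fubini_integral)
  also have "(\<lambda>\<omega>. \<integral>w. cos (sqrt t * lin_comb X a \<omega> * w) \<partial>E) = (\<lambda>\<omega>. 1 / (1 + t * (lin_comb X a \<omega>)\<^sup>2))"
    unfolding E_def exponential_cos_transform using t by (simp add: power_mult_distrib)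
  also have "(\<lambda>w. \<integral>\<omega>. cos (sqrt t * lin_comb X a \<omega> * w) \<partial>M) = (\<lambda>w. re_char ((coord_prod a)\<^sup>2) (sqrt t * w))"
    using expectation_cos_lin_comb[OF a, of "sqrt t * _"] by (simp add: mult_ac)
  finally show ?thesis unfolding E_def ..
qed

lemma expectation_cauchy_antimono:
  assumes "a \<in> feasible" "b \<in> feasible" "(coord_prod a)\<^sup>2 \<le> (coord_prod b)\<^sup>2" "0 \<le> t"
  shows "expectation (\<lambda>\<omega>. 1 / (1 + t * (lin_comb X b \<omega>)\<^sup>2))
     \<le> expectation (\<lambda>\<omega>. 1 / (1 + t * (lin_comb X a \<omega>)\<^sup>2))"
proof -
  interpret E: prob_space "density lborel (exponential_density 1)"
    by (rule prob_space_exponential_density) simp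
  have "integrable (density lborel (exponential_density 1)) (\<lambda>w. re_char ((coord_prod c)\<^sup>2) (sqrt t * w))" for c
    by (rule E.integrable_const_bound[where B = 1])
       (auto simp: re_char_nonneg re_char_le_1, simp add: re_char_def)
  then show ?thesis
    using assms by (simp add: expectation_cauchy integral_mono re_char_antimono)
qed

end

section \<open>Integer moments\<close>

lemma fps_geometric_mult:
  fixes c :: real
  shows "Abs_fps (\<lambda>j. c ^ j) * (1 - fps_const c * fps_X) = 1"
proof (rule fps_ext)
  fix n
  have "Abs_fps (\<lambda>j. c ^ j) * (1 - fps_const c * fps_X)
    = Abs_fps (\<lambda>j. c ^ j) - fps_const c * (fps_X * Abs_fps (\<lambda>j. c ^ j))"
    by (simp add: algebra_simps)
  then show "fps_nth (Abs_fps (\<lambda>j. c ^ j) * (1 - fps_const c * fps_X)) n = fps_nth 1 n"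
    by (cases n) auto
qed

text \<open>
  The coefficients of \<open>1 / (1 - z\<^sup>2 / 2 - p z\<^sup>3)\<close>.
\<close>

fun moment_seq :: "real \<Rightarrow> nat \<Rightarrow> real" where
  "moment_seq p 0 = 1"
| "moment_seq p (Suc 0) = 0"
| "moment_seq p (Suc (Suc 0)) = 1 / 2"
| "moment_seq p (Suc (Suc (Suc k))) = moment_seq p (Suc k) / 2 + p * moment_seq p k"

lemma moment_seq_mono:
  assumes "0 \<le> p" "p \<le> r"
  shows "0 \<le> moment_seq p k \<and> moment_seq p k \<le> moment_seq r k"
  using assms
proof (induction p k rule: moment_seq.induct)
  case (4 p k)
  then show ?case by (auto intro!: add_mono mult_mono)
qed auto

context iid_exponential_triple
begin

text \<open>
  Adding one summand \<open>a $ i * X i\<close> multiplies the generating function of \<open>E S\<^sup>k / k!\<close> by the geometric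
  series of ratio \<open>a $ i\<close>.
\<close>

lemma moment_fps:
  assumes "finite I"
  shows "(\<forall>k. integrable M (\<lambda>\<omega>. (\<Sum>i\<in>I. a $ i * X i \<omega>) ^ k)) \<and>
    Abs_fps (\<lambda>k. expectation (\<lambda>\<omega>. (\<Sum>i\<in>I. a $ i * X i \<omega>) ^ k) / fact k)
      * (\<Prod>i\<in>I. 1 - fps_const (a $ i) * fps_X) = 1"
  using assms
proof induction
  case empty
  have "Abs_fps (\<lambda>k. expectation (\<lambda>\<omega>. 0 ^ k) / fact k) = (1 :: real fps)"
    by (rule fps_ext) (auto simp: power_0_left prob_space)
  then show ?case by (auto simp: power_0_left)
next
  case (insert i I)
  let ?S = "\<lambda>\<omega>. \<Sum>i\<in>I. a $ i * X i \<omega>"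
  let ?h = "\<lambda>k. expectation (\<lambda>\<omega>. ?S \<omega> ^ k) / fact k"
  have "indep_vars (\<lambda>_. borel) (\<lambda>i \<omega>. a $ i * X i \<omega>) (insert i I)"
    by (rule indep_vars_subset[OF indep_vars_compose2[OF indep, where Y = "\<lambda>i x. a $ i * x"]]) auto
  then have ind: "indep_var borel (\<lambda>\<omega>. a $ i * X i \<omega>) borel ?S"
    using insert.hyps by (intro indep_vars_sum)
  have S: "integrable M (\<lambda>\<omega>. ?S \<omega> ^ k)" for k using insert.IH by blast
  note shift = exponential_shift_moment[OF ind exponential S]
  have "Abs_fps (\<lambda>k. expectation (\<lambda>\<omega>. (a $ i * X i \<omega> + ?S \<omega>) ^ k) / fact k)
    = Abs_fps (\<lambda>j. (a $ i) ^ j) * Abs_fps ?h"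
    unfolding shift(2) by (rule fps_ext) (simp add: fps_mult_nth atMost_atLeast0)
  then have "Abs_fps (\<lambda>k. expectation (\<lambda>\<omega>. (a $ i * X i \<omega> + ?S \<omega>) ^ k) / fact k)
      * ((1 - fps_const (a $ i) * fps_X) * (\<Prod>i\<in>I. 1 - fps_const (a $ i) * fps_X))
    = (Abs_fps (\<lambda>j. (a $ i) ^ j) * (1 - fps_const (a $ i) * fps_X))
      * (Abs_fps ?h * (\<Prod>i\<in>I. 1 - fps_const (a $ i) * fps_X))"
    by (simp only: mult_ac)
  also have "\<dots> = 1"
    unfolding fps_geometric_mult using insert.IH by simp
  finally show ?case
    using shift(1) insert.hyps by simp
qed

lemma integrable_power: "integrable M (\<lambda>\<omega>. lin_comb X a \<omega> ^ k)"
  using moment_fps[of UNIV a] by (simp add: lin_comb_eq_sum)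

text \<open>
  Comparing coefficients in \<open>H (1 - z\<^sup>2 / 2 - p z\<^sup>3) = 1\<close> gives the recurrence of \<open>moment_seq\<close>.
\<close>

lemma expectation_power:
  assumes a: "a \<in> feasible"
  shows "expectation (\<lambda>\<omega>. lin_comb X a \<omega> ^ k) = fact k * moment_seq (coord_prod a) k"
proof -
  define H where "H = Abs_fps (\<lambda>k. expectation (\<lambda>\<omega>. lin_comb X a \<omega> ^ k) / fact k)"
  let ?c = "\<lambda>i. fps_const (a $ i)"
  have "a $ 1 + a $ 2 + a $ 3 = 0" using a by (simp add: feasible_def)
  then have "?c 1 + ?c 2 + ?c 3 = 0"
    by (simp only: fps_const_add fps_const_0_eq_0)
  moreover have "?c 1 * ?c 2 + ?c 1 * ?c 3 + ?c 2 * ?c 3 = - fps_const (1 / 2)"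
    using feasible_pairs[OF a] by (simp only: fps_const_add fps_const_mult fps_const_neg) simp
  ultimately have "(1 - ?c 1 * fps_X) * (1 - ?c 2 * fps_X) * (1 - ?c 3 * fps_X)
      = 1 - fps_const (1 / 2) * fps_X\<^sup>2 - (?c 1 * ?c 2 * ?c 3) * fps_X ^ 3"
    by (rule cubic_reciprocal)
  also have "?c 1 * ?c 2 * ?c 3 = fps_const (coord_prod a)"
    by (simp only: fps_const_mult coord_prod_def)
  also have "(1 - ?c 1 * fps_X) * (1 - ?c 2 * fps_X) * (1 - ?c 3 * fps_X) = (\<Prod>i\<in>UNIV. 1 - ?c i * fps_X)"
    unfolding UNIV_3 by (simp add: mult.assoc)
  finally have cubic: "(\<Prod>i\<in>UNIV. 1 - ?c i * fps_X)
      = 1 - fps_const (1 / 2) * fps_X\<^sup>2 - fps_const (coord_prod a) * fps_X ^ 3" .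
  have "H * (1 - fps_const (1 / 2) * fps_X\<^sup>2 - fps_const (coord_prod a) * fps_X ^ 3) = 1"
    using conjunct2[OF moment_fps[OF finite_class.finite_UNIV, of a]] unfolding H_def lin_comb_eq_sum cubic .
  then have H: "H - fps_const (1 / 2) * (fps_X ^ 2 * H) - fps_const (coord_prod a) * (fps_X ^ 3 * H) = 1"
    by (simp only: right_diff_distrib mult_1_right mult_1_left mult_ac)
  have nth: "fps_nth H n - (1 / 2) * (if n < 2 then 0 else fps_nth H (n - 2))
     - coord_prod a * (if n < 3 then 0 else fps_nth H (n - 3)) = (if n = 0 then 1 else 0)" for n
    using arg_cong[OF H, of "\<lambda>f. fps_nth f n"]
    by (simp only: fps_sub_nth fps_mult_left_const_nth fps_X_power_mult_nth fps_one_nth)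
  have "fps_nth H k = moment_seq (coord_prod a) k"
  proof (induction "coord_prod a" k rule: moment_seq.induct)
    case (4 k)
    then show ?case using nth[of "k + 3"] by (simp add: numeral_eq_Suc)
  qed (use nth[of 0] nth[of 1] nth[of 2] in \<open>auto simp: numeral_eq_Suc\<close>)
  then show ?thesis by (simp add: H_def field_simps)
qed

end

section \<open>Fractional absolute moments\<close>

context iid_exponential_triple
begin

lemma integrable_cauchy_power:
  assumes "0 \<le> t"
  shows "integrable M (\<lambda>\<omega>. lin_comb X a \<omega> ^ (2 * m) / (1 + t * (lin_comb X a \<omega>)\<^sup>2))"
proof (rule Bochner_Integration.integrable_bound[OF integrable_power[of a "2 * m"]])
  show "AE \<omega> in M. norm (lin_comb X a \<omega> ^ (2 * m) / (1 + t * (lin_comb X a \<omega>)\<^sup>2))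
     \<le> norm (lin_comb X a \<omega> ^ (2 * m))"
  proof (rule AE_I2)
    fix \<omega>
    have "1 \<le> 1 + t * (lin_comb X a \<omega>)\<^sup>2" using assms by simp
    then show "norm (lin_comb X a \<omega> ^ (2 * m) / (1 + t * (lin_comb X a \<omega>)\<^sup>2))
       \<le> norm (lin_comb X a \<omega> ^ (2 * m))"
      by (simp add: divide_le_eq mult_le_cancel_left1)
  qed
qed measurable

text \<open>
  Each increase of \<open>m\<close> reverses the direction, because
  \<open>y\<^sup>m\<^sup>+\<^sup>1 / (1 + t y) = (y\<^sup>m - y\<^sup>m / (1 + t y)) / t\<close> with \<open>y = Y\<^sup>2\<close>, and the moments \<open>E Y\<^sup>2\<^sup>m\<close> subtracted
  for \<open>m = 0, 1, 2\<close> do not depend on the point.  The bound \<open>m \<le> 3\<close> is where this stops: \<open>E Y\<^sup>6\<close> does depend on it.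
\<close>

lemma expectation_cauchy_power_mono:
  assumes ab: "a \<in> feasible" "b \<in> feasible" "(coord_prod a)\<^sup>2 \<le> (coord_prod b)\<^sup>2" and t: "0 < t" and "m \<le> 3"
  shows "(- 1) ^ m * expectation (\<lambda>\<omega>. lin_comb X b \<omega> ^ (2 * m) / (1 + t * (lin_comb X b \<omega>)\<^sup>2))
    \<le> (- 1) ^ m * expectation (\<lambda>\<omega>. lin_comb X a \<omega> ^ (2 * m) / (1 + t * (lin_comb X a \<omega>)\<^sup>2))"
  using \<open>m \<le> 3\<close>
proof (induction m)
  case 0
  then show ?case using expectation_cauchy_antimono[OF ab, of t] t by simp
next
  case (Suc m)
  have eq: "expectation (\<lambda>\<omega>. lin_comb X c \<omega> ^ (2 * Suc m) / (1 + t * (lin_comb X c \<omega>)\<^sup>2))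
    = (expectation (\<lambda>\<omega>. lin_comb X c \<omega> ^ (2 * m))
       - expectation (\<lambda>\<omega>. lin_comb X c \<omega> ^ (2 * m) / (1 + t * (lin_comb X c \<omega>)\<^sup>2))) / t" for c
  proof -
    have "y ^ (2 * Suc m) / (1 + t * y\<^sup>2) = (y ^ (2 * m) - y ^ (2 * m) / (1 + t * y\<^sup>2)) / t" for y :: real
    proof -
      define d where "d = 1 + t * y\<^sup>2"
      have "1 \<le> d" using t by (simp add: d_def)
      moreover have "y ^ (2 * Suc m) = y ^ (2 * m) * ((d - 1) / t)"
        using t by (simp add: d_def power2_eq_square)
      ultimately show ?thesis using t unfolding d_def[symmetric] by (simp add: field_simps)
    qed
    then show ?thesis
      using t by (simp add: integrable_power integrable_cauchy_power Bochner_Integration.integral_diff)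
  qed
  have "m = 0 \<or> m = 1 \<or> m = 2" using Suc.prems by auto
  then have "moment_seq (coord_prod a) (2 * m) = moment_seq (coord_prod b) (2 * m)"
    by (auto simp: numeral_eq_Suc)
  then have "expectation (\<lambda>\<omega>. lin_comb X a \<omega> ^ (2 * m)) = expectation (\<lambda>\<omega>. lin_comb X b \<omega> ^ (2 * m))"
    using ab by (simp add: expectation_power)
  moreover have "(- 1) ^ Suc m * ((e - x) / t) = ((- 1) ^ m * x - (- 1) ^ m * e) / t" for e x :: real
    using t by (simp add: field_simps)
  ultimately show ?case
    using Suc t unfolding eq by (simp only:) (simp add: divide_right_mono)
qed

lemma nn_integral_stieltjes:
  shows "(\<integral>\<^sup>+\<omega>. ennreal (lin_comb X a \<omega> ^ (2 * m)) * stieltjes \<kappa> ((lin_comb X a \<omega>)\<^sup>2) \<partial>M)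
    = (\<integral>\<^sup>+t. ennreal (t powr (\<kappa> - 1) *
         expectation (\<lambda>\<omega>. lin_comb X a \<omega> ^ (2 * m) / (1 + t * (lin_comb X a \<omega>)\<^sup>2))) * indicator {0<..} t \<partial>lborel)"
proof -
  interpret P: pair_sigma_finite M lborel ..
  let ?f = "\<lambda>\<omega> t. ennreal (t powr (\<kappa> - 1) * (lin_comb X a \<omega> ^ (2 * m) / (1 + t * (lin_comb X a \<omega>)\<^sup>2))) * indicator {0<..} t"
  have "ennreal (lin_comb X a \<omega> ^ (2 * m)) * stieltjes \<kappa> ((lin_comb X a \<omega>)\<^sup>2) = (\<integral>\<^sup>+t. ?f \<omega> t \<partial>lborel)" for \<omega>
  proof -
    have "ennreal u * (ennreal (t powr (\<kappa> - 1) / (1 + t * y\<^sup>2)) * indicator {0<..} t)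
      = ennreal (t powr (\<kappa> - 1) * (u / (1 + t * y\<^sup>2))) * indicator {0<..} t"
      if "0 \<le> u" for t y u :: real
      using that by (cases "0 < t") (simp_all add: ennreal_mult'[symmetric] mult.commute)
    from this[of "lin_comb X a \<omega> ^ (2 * m)"] show ?thesis
      unfolding stieltjes_def by (subst nn_integral_cmult[symmetric]) simp_all
  qed
  then have "(\<integral>\<^sup>+\<omega>. ennreal (lin_comb X a \<omega> ^ (2 * m)) * stieltjes \<kappa> ((lin_comb X a \<omega>)\<^sup>2) \<partial>M)
      = (\<integral>\<^sup>+\<omega>. (\<integral>\<^sup>+t. ?f \<omega> t \<partial>lborel) \<partial>M)" by simp
  also have "\<dots> = (\<integral>\<^sup>+t. (\<integral>\<^sup>+\<omega>. ?f \<omega> t \<partial>M) \<partial>lborel)"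
    by (rule P.Fubini'[symmetric]) measurable
  also have "\<dots> = (\<integral>\<^sup>+t. ennreal (t powr (\<kappa> - 1) *
         expectation (\<lambda>\<omega>. lin_comb X a \<omega> ^ (2 * m) / (1 + t * (lin_comb X a \<omega>)\<^sup>2))) * indicator {0<..} t \<partial>lborel)"
  proof (rule nn_integral_cong)
    fix t :: real
    show "(\<integral>\<^sup>+\<omega>. ?f \<omega> t \<partial>M) = ennreal (t powr (\<kappa> - 1) *
         expectation (\<lambda>\<omega>. lin_comb X a \<omega> ^ (2 * m) / (1 + t * (lin_comb X a \<omega>)\<^sup>2))) * indicator {0<..} t"
    proof (cases "0 < t")
      case True
      have "(\<integral>\<^sup>+\<omega>. ennreal (t powr (\<kappa> - 1) * (lin_comb X a \<omega> ^ (2 * m) / (1 + t * (lin_comb X a \<omega>)\<^sup>2))) \<partial>M)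
        = ennreal (expectation (\<lambda>\<omega>. t powr (\<kappa> - 1) * (lin_comb X a \<omega> ^ (2 * m) / (1 + t * (lin_comb X a \<omega>)\<^sup>2))))"
        using True integrable_cauchy_power[of t a m]
        by (intro nn_integral_eq_integral integrable_mult_right) auto
      also have "expectation (\<lambda>\<omega>. t powr (\<kappa> - 1) * (lin_comb X a \<omega> ^ (2 * m) / (1 + t * (lin_comb X a \<omega>)\<^sup>2)))
        = t powr (\<kappa> - 1) * expectation (\<lambda>\<omega>. lin_comb X a \<omega> ^ (2 * m) / (1 + t * (lin_comb X a \<omega>)\<^sup>2))"
        by (rule integral_mult_right_zero)
      finally show ?thesis using True by simp
    qed simp
  qed
  finally show ?thesis .
qed

text \<open>
  Since \<open>re_char P \<le> re_char 0\<close>, the Cauchy averages are at most those for \<open>P = 0\<close>, where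
  \<open>re_char 0 (\<surd>t w) = 1 / (1 + t w\<^sup>2 / 2)\<close> is itself a Cauchy kernel.  Integrating over \<open>t\<close> leaves a
  multiple of the moment of order \<open>- 2 \<kappa> > - 1\<close> of an exponential variable.
\<close>

lemma nn_integral_stieltjes_finite:
  assumes a: "a \<in> feasible" and k: "0 < \<kappa>" "\<kappa> < 1 / 2"
  shows "(\<integral>\<^sup>+\<omega>. stieltjes \<kappa> ((lin_comb X a \<omega>)\<^sup>2) \<partial>M) < \<infinity>"
proof -
  define E where "E = density lborel (exponential_density 1)"
  have sE [measurable_cong]: "sets E = sets borel" by (simp add: E_def)
  interpret E: prob_space E unfolding E_def by (rule prob_space_exponential_density) simp
  interpret P: pair_sigma_finite E lborel ..
  let ?f = "\<lambda>w t. ennreal (t powr (\<kappa> - 1) / (1 + t * (w\<^sup>2 / 2))) * indicator {0<..} t"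
  have "(\<integral>\<^sup>+\<omega>. stieltjes \<kappa> ((lin_comb X a \<omega>)\<^sup>2) \<partial>M)
    = (\<integral>\<^sup>+t. ennreal (t powr (\<kappa> - 1) *
         expectation (\<lambda>\<omega>. 1 / (1 + t * (lin_comb X a \<omega>)\<^sup>2))) * indicator {0<..} t \<partial>lborel)"
    using nn_integral_stieltjes[of a 0 \<kappa>] by simp
  also have "\<dots> \<le> (\<integral>\<^sup>+t. (\<integral>\<^sup>+w. ?f w t \<partial>E) \<partial>lborel)"
  proof (rule nn_integral_mono)
    fix t :: real
    show "ennreal (t powr (\<kappa> - 1) * expectation (\<lambda>\<omega>. 1 / (1 + t * (lin_comb X a \<omega>)\<^sup>2))) * indicator {0<..} t
        \<le> (\<integral>\<^sup>+w. ?f w t \<partial>E)"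
    proof (cases "0 < t")
      case True
      have int: "integrable E (\<lambda>w. re_char (p\<^sup>2) (sqrt t * w))" for p
        by (rule E.integrable_const_bound[where B = 1])
           (auto simp: re_char_nonneg re_char_le_1, simp add: re_char_def)
      have "expectation (\<lambda>\<omega>. 1 / (1 + t * (lin_comb X a \<omega>)\<^sup>2)) \<le> (\<integral>w. re_char 0 (sqrt t * w) \<partial>E)"
        using a True int[of "coord_prod a"] int[of 0]
        by (simp add: expectation_cauchy flip: E_def) (intro integral_mono re_char_antimono, auto)
      then have "ennreal (t powr (\<kappa> - 1) * expectation (\<lambda>\<omega>. 1 / (1 + t * (lin_comb X a \<omega>)\<^sup>2)))
        \<le> ennreal (\<integral>w. t powr (\<kappa> - 1) * re_char 0 (sqrt t * w) \<partial>E)"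
        by (intro ennreal_leI) (simp add: mult_left_mono)
      also have "\<dots> = (\<integral>\<^sup>+w. ennreal (t powr (\<kappa> - 1) * re_char 0 (sqrt t * w)) \<partial>E)"
        using int[of 0] by (intro nn_integral_eq_integral[symmetric]) (auto simp: re_char_nonneg)
      finally show ?thesis
        using True by (simp add: re_char_0 power_mult_distrib)
    qed simp
  qed
  also have "\<dots> = (\<integral>\<^sup>+w. stieltjes \<kappa> (w\<^sup>2 / 2) \<partial>E)"
    unfolding stieltjes_def by (rule P.Fubini') measurable
  also have "\<dots> = (\<integral>\<^sup>+w. ennreal (2 powr \<kappa>) * stieltjes \<kappa> 1 * ennreal (w powr (- 2 * \<kappa>)) \<partial>E)"
  proof (rule nn_integral_cong_AE)
    have "AE w in E. 0 < w"
      unfolding E_def using AE_lborel_singleton[of 0]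
      by (subst AE_density) (auto simp: exponential_density_def)
    then show "AE w in E. stieltjes \<kappa> (w\<^sup>2 / 2) = ennreal (2 powr \<kappa>) * stieltjes \<kappa> 1 * ennreal (w powr (- 2 * \<kappa>))"
    proof eventually_elim
      case (elim w)
      then have "(w\<^sup>2 / 2) powr (- \<kappa>) = 2 powr \<kappa> * w powr (- 2 * \<kappa>)"
        by (simp add: powr_divide powr_powr powr_minus field_simps powr_numeral[symmetric] del: powr_numeral)
      then show ?case
        using elim stieltjes_scale[of "w\<^sup>2 / 2" \<kappa>] by (simp add: ennreal_mult mult_ac)
    qed
  qed
  also have "\<dots> = ennreal (2 powr \<kappa>) * stieltjes \<kappa> 1 * (\<integral>\<^sup>+w. ennreal (w powr (- 2 * \<kappa>)) \<partial>E)"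
    by (rule nn_integral_cmult) measurable
  also have "\<dots> < \<infinity>"
    using nn_integral_exponential_powr_finite[of "- 2 * \<kappa>"] stieltjes_finite[of \<kappa>] k
    unfolding E_def by (simp add: ennreal_mult_less_top)
  finally show ?thesis .
qed

text \<open>
  A finite integral forces the integrand to be finite almost surely, while \<open>stieltjes \<kappa> 0 = \<infinity>\<close>.  The
  value \<open>\<kappa> = 1/4\<close> is one choice from the admissible range \<open>0 < \<kappa> < 1/2\<close>.
\<close>

lemma AE_lin_comb_nonzero:
  assumes "a \<in> feasible"
  shows "AE \<omega> in M. lin_comb X a \<omega> \<noteq> 0"
proof -
  have "AE \<omega> in M. stieltjes (1 / 4) ((lin_comb X a \<omega>)\<^sup>2) \<noteq> \<infinity>"
    using nn_integral_stieltjes_finite[OF assms, of "1 / 4"] by (intro nn_integral_noteq_infinite) auto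
  then show ?thesis
    by eventually_elim (use stieltjes_0[of "1 / 4"] in auto)
qed

text \<open>
  Pointwise, \<open>\<bar>y\<bar>\<^sup>2\<^sup>m\<^sup>-\<^sup>2\<^sup>\<kappa> = y\<^sup>2\<^sup>m (y\<^sup>2)\<^sup>-\<^sup>\<kappa>\<close> and the scaling of the Stieltjes transform applies.  At
  \<open>y = 0\<close> with \<open>m = 0\<close> the two integrands differ (\<open>0\<close> against \<open>\<infinity>\<close>), hence the appeal to a null set.
\<close>

lemma nn_abs_moment_stieltjes:
  assumes "a \<in> feasible"
  shows "(\<integral>\<^sup>+\<omega>. ennreal (\<bar>lin_comb X a \<omega>\<bar> powr (2 * real m - 2 * \<kappa>)) \<partial>M) * stieltjes \<kappa> 1
    = (\<integral>\<^sup>+\<omega>. ennreal (lin_comb X a \<omega> ^ (2 * m)) * stieltjes \<kappa> ((lin_comb X a \<omega>)\<^sup>2) \<partial>M)"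
proof -
  have "(\<integral>\<^sup>+\<omega>. ennreal (\<bar>lin_comb X a \<omega>\<bar> powr (2 * real m - 2 * \<kappa>)) * stieltjes \<kappa> 1 \<partial>M)
    = (\<integral>\<^sup>+\<omega>. ennreal (lin_comb X a \<omega> ^ (2 * m)) * stieltjes \<kappa> ((lin_comb X a \<omega>)\<^sup>2) \<partial>M)"
  proof (rule nn_integral_cong_AE, use AE_lin_comb_nonzero[OF assms] in eventually_elim)
    case (elim \<omega>)
    let ?y = "\<bar>lin_comb X a \<omega>\<bar>"
    have "?y powr (2 * real m - 2 * \<kappa>) = ?y powr real (2 * m) * ?y powr (2 * (- \<kappa>))"
      unfolding powr_add[symmetric] by simp
    also have "?y powr real (2 * m) = lin_comb X a \<omega> ^ (2 * m)"
      using elim by (subst powr_realpow) (auto simp: power_even_abs)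
    also have "?y powr (2 * (- \<kappa>)) = (?y powr 2) powr (- \<kappa>)"
      by (simp only: powr_powr)
    also have "?y powr 2 = (lin_comb X a \<omega>)\<^sup>2"
      using elim by (simp add: powr_numeral)
    finally have "ennreal (?y powr (2 * real m - 2 * \<kappa>))
        = ennreal (lin_comb X a \<omega> ^ (2 * m)) * ennreal ((lin_comb X a \<omega>)\<^sup>2 powr (- \<kappa>))"
      by (simp add: ennreal_mult'')
    then show ?case
      using elim stieltjes_scale[of "(lin_comb X a \<omega>)\<^sup>2" \<kappa>] by (simp add: mult_ac)
  qed
  then show ?thesis by (subst (asm) nn_integral_multc) auto
qed

lemma integrable_abs_powr:
  assumes a: "a \<in> feasible" and q: "- 1 < q"
  shows "integrable M (\<lambda>\<omega>. \<bar>lin_comb X a \<omega>\<bar> powr q)"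
proof (cases "q < 0")
  case True
  have "(\<integral>\<^sup>+\<omega>. ennreal (\<bar>lin_comb X a \<omega>\<bar> powr q) \<partial>M) * stieltjes (- q / 2) 1 < \<infinity>"
    using nn_abs_moment_stieltjes[OF a, of 0 "- q / 2"] nn_integral_stieltjes_finite[OF a, of "- q / 2"] q True
    by simp
  then have "(\<integral>\<^sup>+\<omega>. ennreal (\<bar>lin_comb X a \<omega>\<bar> powr q) \<partial>M) < \<infinity>"
    using stieltjes_pos[of "- q / 2"] by (auto simp: ennreal_mult_less_top)
  then show ?thesis by (intro integrableI_nonneg) auto
next
  case False
  define n where "n = nat \<lceil>q\<rceil>"
  show ?thesis
  proof (rule Bochner_Integration.integrable_bound)
    show "integrable M (\<lambda>\<omega>. 1 + lin_comb X a \<omega> ^ (2 * n))"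
      by (intro Bochner_Integration.integrable_add integrable_power) simp
    have "\<bar>y\<bar> powr q \<le> 1 + y ^ (2 * n)" for y :: real
    proof (cases "\<bar>y\<bar> \<le> 1")
      case True
      then have "\<bar>y\<bar> powr q \<le> 1" using False by (simp add: powr_le1)
      then show ?thesis by (simp add: add_increasing2)
    next
      case y: False
      have "\<bar>y\<bar> powr q \<le> \<bar>y\<bar> powr real (2 * n)"
        using y False unfolding n_def by (intro powr_mono) linarith+
      also have "\<dots> = y ^ (2 * n)"
        using y by (subst powr_realpow) (auto simp: power_even_abs)
      finally show ?thesis by simp
    qed
    then show "AE \<omega> in M. norm (\<bar>lin_comb X a \<omega>\<bar> powr q) \<le> norm (1 + lin_comb X a \<omega> ^ (2 * n))"
      by (intro AE_I2) (simp add: abs_of_nonneg)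
  qed measurable
qed

text \<open>
  The inequality for \<open>E (Y\<^sup>2\<^sup>m / (1 + t Y\<^sup>2))\<close> holds for each \<open>t > 0\<close> and survives integration against
  \<open>t\<^sup>\<kappa>\<^sup>-\<^sup>1 dt\<close>.
\<close>

lemma abs_moment_mono:
  assumes ab: "a \<in> feasible" "b \<in> feasible" "(coord_prod a)\<^sup>2 \<le> (coord_prod b)\<^sup>2"
    and m: "m \<le> 3" and k: "0 < \<kappa>" "\<kappa> < 1" and q: "- 1 < 2 * real m - 2 * \<kappa>"
  shows "(- 1) ^ m * abs_moment M X (2 * real m - 2 * \<kappa>) b
    \<le> (- 1) ^ m * abs_moment M X (2 * real m - 2 * \<kappa>) a"
proof -
  obtain c where c: "0 < c" "stieltjes \<kappa> 1 = ennreal c"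
    using stieltjes_finite[OF k] stieltjes_pos[of \<kappa>] by (cases "stieltjes \<kappa> 1") auto
  let ?T = "\<lambda>a t. expectation (\<lambda>\<omega>. lin_comb X a \<omega> ^ (2 * m) / (1 + t * (lin_comb X a \<omega>)\<^sup>2))"
  let ?m = "abs_moment M X (2 * real m - 2 * \<kappa>)"
  have nonneg: "0 \<le> ?m a" for a
    unfolding abs_moment_def by (rule Bochner_Integration.integral_nonneg) simp
  have rep: "ennreal (?m a * c) = (\<integral>\<^sup>+t. ennreal (t powr (\<kappa> - 1) * ?T a t) * indicator {0<..} t \<partial>lborel)"
    if "a \<in> feasible" for a
  proof -
    have "ennreal (?m a) = (\<integral>\<^sup>+\<omega>. ennreal (\<bar>lin_comb X a \<omega>\<bar> powr (2 * real m - 2 * \<kappa>)) \<partial>M)"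
      unfolding abs_moment_def
      by (rule nn_integral_eq_integral[symmetric]) (use integrable_abs_powr[OF that q] in auto)
    then show ?thesis
      using nn_abs_moment_stieltjes[OF that, of m \<kappa>] nonneg[of a] c
      by (simp add: nn_integral_stieltjes ennreal_mult)
  qed
  have le: "?m x \<le> ?m y" if "x \<in> feasible" "y \<in> feasible" "\<And>t. 0 < t \<Longrightarrow> ?T x t \<le> ?T y t" for x y
  proof -
    have "ennreal (?m x * c) \<le> ennreal (?m y * c)"
      unfolding rep[OF that(1)] rep[OF that(2)]
      by (intro nn_integral_mono) (auto simp: indicator_def intro!: ennreal_leI mult_left_mono that(3))
    then show ?thesis using c nonneg[of y] by simp
  qed
  note mono = expectation_cauchy_power_mono[OF ab _ m]
  show ?thesis
  proof (cases "even m")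
    case True
    then show ?thesis using le[of b a] mono ab by simp
  next
    case False
    then show ?thesis using le[of a b] mono ab by simp
  qed
qed

end

section \<open>Odd absolute moments\<close>

text \<open>
  The value of \<open>E (sgn Y \<cdot> Y\<^sup>k) / k!\<close> when \<open>c\<close> is the only positive coordinate; the product of the
  coordinates is then \<open>c (c\<^sup>2 - 1/2)\<close>.
\<close>

definition signed_seq :: "real \<Rightarrow> nat \<Rightarrow> real" where
  "signed_seq c k = 2 * c ^ (k + 2) / (3 * c\<^sup>2 - 1 / 2) - moment_seq (c * (c\<^sup>2 - 1 / 2)) k"

text \<open>
  Since \<open>c\<close> is a root of \<open>x\<^sup>3 - x / 2 - c (c\<^sup>2 - 1/2)\<close>, the powers of \<open>c\<close> satisfy the recurrence of
  \<open>moment_seq\<close>.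
\<close>

lemma signed_seq_rec:
  "signed_seq c (k + 3) = signed_seq c (k + 1) / 2 + c * (c\<^sup>2 - 1 / 2) * signed_seq c k"
proof -
  have "c ^ (k + 3 + 2) = c ^ (k + 1 + 2) / 2 + c * (c\<^sup>2 - 1 / 2) * c ^ (k + 2)"
    by (simp add: power_add power2_eq_square algebra_simps numeral_eq_Suc)
  then have "2 * c ^ (k + 3 + 2) / D = 2 * c ^ (k + 1 + 2) / D / 2 + c * (c\<^sup>2 - 1 / 2) * (2 * c ^ (k + 2) / D)" for D
    by (simp only:) (simp add: add_divide_distrib)
  moreover have "moment_seq p (k + 3) = moment_seq p (k + 1) / 2 + p * moment_seq p k" for p
    by (simp add: numeral_eq_Suc)
  ultimately show ?thesis
    unfolding signed_seq_def by (simp only:) (simp add: algebra_simps diff_divide_distrib)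
qed

text \<open>
  The recurrence propagates nonnegativity and monotonicity from three consecutive terms.  With
  \<open>y = c\<^sup>2\<close>, the fourth term is \<open>?F y - 1/4\<close>, which vanishes at \<open>y = 1/2\<close> and increases.  In the sixth
  term the contribution \<open>c (c\<^sup>2 - 1/2) signed_seq c 3\<close> factors as \<open>?A y * ?B y\<close> with both factors
  nonnegative and increasing, although \<open>signed_seq c 3\<close> is decreasing.  The fifth term enters as a
  hypothesis, since its monotonicity is an instance of the fractional case.
\<close>

lemma signed_seq_mono:
  assumes c: "0 < c" "1 / 2 \<le> c\<^sup>2" and cd: "c \<le> d" and d: "d\<^sup>2 \<le> 2 / 3"
    and five: "0 \<le> signed_seq c 5" "signed_seq c 5 \<le> signed_seq d 5"
  shows "0 \<le> signed_seq c (k + 4) \<and> signed_seq c (k + 4) \<le> signed_seq d (k + 4)"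
proof -
  let ?p = "\<lambda>c::real. c * (c\<^sup>2 - 1 / 2)"
  have d0: "0 < d" using c cd by simp
  have yx: "c\<^sup>2 \<le> d\<^sup>2" using c cd by (intro power_mono) auto
  have d12: "1 / 2 \<le> d\<^sup>2" using c yx by linarith
  have p: "0 \<le> ?p c" "?p c \<le> ?p d"
    using c cd yx by (auto intro!: mult_mono)
  let ?F = "\<lambda>y::real. 2 * y ^ 3 / (3 * y - 1 / 2)"
  let ?A = "\<lambda>y::real. y * (y - 1 / 2) / (3 * y - 1 / 2)"
  let ?B = "\<lambda>y::real. 2 * y - y\<^sup>2 - 1 / 4"
  have cross: "u / e \<le> v / f" if "u * f \<le> v * e" "0 < e" "0 < f" for u v e f :: real
    using that by (simp add: field_simps)
  have F: "?F y \<le> ?F x" and A: "0 \<le> ?A y" "?A y \<le> ?A x" and B: "0 \<le> ?B y" "?B y \<le> ?B x"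
    if yx: "1 / 2 \<le> y" "y \<le> x" "x \<le> 2 / 3" for x y :: real
  proof -
    have xy: "x / 2 \<le> x * y" "y / 2 \<le> x * y" "1 / 4 \<le> x * y"
      using yx mult_mono[of x x "1/2" y] mult_mono[of "1/2" x y y] mult_mono[of "1/2" x "1/2" y] by auto
    \<comment> \<open>half the difference of the cross products of \<open>?F x\<close> and \<open>?F y\<close>\<close>
    have "0 \<le> (x - y) * (3 * (x * y) * (x + y) - (x\<^sup>2 + x * y + y\<^sup>2) / 2)"
    proof (rule mult_nonneg_nonneg)
      have "x\<^sup>2 + x * y + y\<^sup>2 \<le> (x + y)\<^sup>2" using yx by (simp add: power2_eq_square algebra_simps)
      moreover have "(x + y) * (x + y) \<le> (4 * (x * y)) * (x + y)"
      proof (rule mult_right_mono)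
        show "x + y \<le> 4 * (x * y)" using xy by linarith
      qed (use yx in auto)
      moreover have "0 \<le> (x * y) * (x + y)" using yx by auto
      ultimately show "0 \<le> 3 * (x * y) * (x + y) - (x\<^sup>2 + x * y + y\<^sup>2) / 2"
        by (simp add: power2_eq_square)
    qed (use yx in auto)
    then have "2 * y ^ 3 * (3 * x - 1 / 2) \<le> 2 * x ^ 3 * (3 * y - 1 / 2)"
      by (simp add: power2_eq_square power3_eq_cube algebra_simps diff_divide_distrib add_divide_distrib)
    then show "?F y \<le> ?F x" by (rule cross) (use yx in auto)
    show "0 \<le> ?A y" using yx by simp
    \<comment> \<open>again the difference of the cross products, now for \<open>?A\<close>\<close>
    have "0 \<le> (x - y) * (3 * (x * y) - (x + y) / 2 + 1 / 4)"
    proof (rule mult_nonneg_nonneg)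
      have "(x + y) / 2 = x / 2 + y / 2" by (rule add_divide_distrib)
      then show "0 \<le> 3 * (x * y) - (x + y) / 2 + 1 / 4" using xy by linarith
    qed (use yx in auto)
    then have "y * (y - 1 / 2) * (3 * x - 1 / 2) \<le> x * (x - 1 / 2) * (3 * y - 1 / 2)"
      by (simp add: algebra_simps power2_eq_square diff_divide_distrib add_divide_distrib)
    then show "?A y \<le> ?A x" by (rule cross) (use yx in auto)
    have "0 \<le> (x - y) * (2 - (x + y))" using yx by (intro mult_nonneg_nonneg) auto
    then show "?B y \<le> ?B x" by (simp add: power2_eq_square algebra_simps)
    have "y\<^sup>2 \<le> y" using yx mult_mono[of y 1 y y] by (simp add: power2_eq_square)
    then show "0 \<le> ?B y" using yx by linarith
  qed
  have four: "signed_seq e 4 = ?F (e\<^sup>2) - 1 / 4" for e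
    by (simp add: signed_seq_def numeral_eq_Suc flip: power_mult)
  have six: "signed_seq e 6 = signed_seq e 4 / 2 + ?A (e\<^sup>2) * ?B (e\<^sup>2)" if "1 / 2 \<le> e\<^sup>2" for e
  proof -
    have D: "3 * e\<^sup>2 - 1 / 2 \<noteq> 0" using that by auto
    have "signed_seq e 3 = 2 * e ^ 5 / (3 * e\<^sup>2 - 1 / 2) - ?p e"
      by (simp add: signed_seq_def numeral_eq_Suc)
    then have "?p e * signed_seq e 3 * (3 * e\<^sup>2 - 1 / 2) = ?p e * (2 * e ^ 5 - ?p e * (3 * e\<^sup>2 - 1 / 2))"
      using D by (simp add: left_diff_distrib)
    also have "\<dots> = (e\<^sup>2 * (e\<^sup>2 - 1 / 2)) * ?B (e\<^sup>2)"
      by algebra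
    finally have "?p e * signed_seq e 3 = ?A (e\<^sup>2) * ?B (e\<^sup>2)"
      using D by (simp add: eq_divide_eq)
    then show ?thesis using signed_seq_rec[of e 3] by simp
  qed
  have y: "1 / 2 \<le> c\<^sup>2" "c\<^sup>2 \<le> d\<^sup>2" "d\<^sup>2 \<le> 2 / 3" using c yx d by auto
  have b4: "0 \<le> signed_seq c 4" "signed_seq c 4 \<le> signed_seq d 4"
    using F[of "1 / 2" "c\<^sup>2"] F[OF y] y unfolding four by (auto simp: power3_eq_cube)
  have b6: "0 \<le> signed_seq c 6" "signed_seq c 6 \<le> signed_seq d 6"
    using six[of c] six[of d] b4 y A[OF y] B[OF y] mult_mono[OF A(2)[OF y] B(2)[OF y]]
    by (auto intro: order_trans)
  show ?thesis
  proof (induction k rule: less_induct)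
    case (less k)
    consider "k = 0" | "k = 1" | "k = 2" | j where "k = j + 3"
    proof -
      have "k = 0 \<or> k = 1 \<or> k = 2 \<or> k = (k - 3) + 3" by arith
      then show ?thesis using that by blast
    qed
    then show ?case
    proof cases
      case (4 j)
      have e: "k + 4 = (j + 4) + 3" "(j + 4) + 1 = (j + 1) + 4" using 4 by auto
      have rec: "signed_seq e (k + 4) = signed_seq e ((j + 1) + 4) / 2 + ?p e * signed_seq e (j + 4)" for e
        unfolding e(1) signed_seq_rec e(2) ..
      show ?thesis
        unfolding rec using less.IH[of j] less.IH[of "j + 1"] 4 p d0 c d12
        by (auto intro!: add_nonneg_nonneg add_mono mult_mono mult_nonneg_nonneg)
    qed (use b4 b6 five in auto)
  qed
qed

context iid_exponential_triple
begin

lemma AE_nonneg: "AE \<omega> in M. 0 \<le> X i \<omega>"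
  by (subst distributed_AE2[OF exponential]) (auto simp: exponential_density_def)

text \<open>
  Condition on the remaining summands: their sum \<open>S\<close> is nonpositive and independent of \<open>X i\<close>, so
  memorylessness applies with \<open>z = S\<close>, and \<open>E (exp (S / c))\<close> factors by independence.
\<close>

lemma nn_integral_positive_part:
  assumes c: "0 < a $ i" and neg: "\<And>j. j \<noteq> i \<Longrightarrow> a $ j \<le> 0" and k: "0 < k"
  shows "(\<integral>\<^sup>+\<omega>. ennreal (max 0 (lin_comb X a \<omega>) ^ k) \<partial>M)
    = ennreal (fact k * (a $ i) ^ k * (\<Prod>j\<in>UNIV - {i}. 1 / (1 - a $ j / a $ i)))"
proof -
  define c where "c = a $ i"
  define S where "S \<omega> = (\<Sum>j\<in>UNIV - {i}. a $ j * X j \<omega>)" for \<omega>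
  define E where "E = density lborel (exponential_density 1)"
  have c0: "0 < c" using c by (simp add: c_def)
  have S [measurable]: "S \<in> borel_measurable M" unfolding S_def by measurable
  have Y: "lin_comb X a \<omega> = c * X i \<omega> + S \<omega>" for \<omega>
    unfolding lin_comb_eq_sum S_def c_def by (subst sum.remove[of UNIV i]) auto
  \<comment> \<open>\<open>X i\<close> itself together with the scaled remaining variables\<close>
  let ?W = "\<lambda>j \<omega>. (if j = i then 1 else a $ j) * X j \<omega>"
  have "insert i (UNIV - {i}) = UNIV" by auto
  then have "indep_vars (\<lambda>_. borel) ?W (insert i (UNIV - {i}))"
    by (simp only:) (rule indep_vars_compose2[OF indep, where Y = "\<lambda>j x. (if j = i then 1 else a $ j) * x"], simp)
  then have "indep_var borel (?W i) borel (\<lambda>\<omega>. \<Sum>j\<in>UNIV - {i}. ?W j \<omega>)"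
    by (intro indep_vars_sum) auto
  also have "(\<lambda>\<omega>. \<Sum>j\<in>UNIV - {i}. ?W j \<omega>) = S"
    unfolding S_def by (intro ext sum.cong) auto
  finally have "indep_var borel (X i) borel S" by simp
  then have pair: "distr M borel (X i) \<Otimes>\<^sub>M distr M borel S = distr M (borel \<Otimes>\<^sub>M borel) (\<lambda>\<omega>. (X i \<omega>, S \<omega>))"
    by (simp add: indep_var_distribution_eq)
  have "distr M borel (X i) = distr M lborel (X i)" by (rule distr_cong) auto
  also have "\<dots> = E" unfolding E_def by (rule distributed_distr_eq_density[OF exponential])
  finally have E: "distr M borel (X i) = E" .
  have sE [measurable_cong]: "sets E = sets borel" by (simp add: E_def)
  interpret E: prob_space E unfolding E_def by (rule prob_space_exponential_density) simp
  interpret S: prob_space "distr M borel S" by (rule prob_space_distr) measurable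
  interpret P: pair_sigma_finite E "distr M borel S" ..
  have "(\<integral>\<^sup>+\<omega>. ennreal (max 0 (lin_comb X a \<omega>) ^ k) \<partial>M)
    = (\<integral>\<^sup>+xs. ennreal (max 0 (c * fst xs + snd xs) ^ k) \<partial>distr M (borel \<Otimes>\<^sub>M borel) (\<lambda>\<omega>. (X i \<omega>, S \<omega>)))"
    by (subst nn_integral_distr) (auto simp: Y)
  also have "\<dots> = (\<integral>\<^sup>+s. \<integral>\<^sup>+x. ennreal (max 0 (c * x + s) ^ k) \<partial>E \<partial>distr M borel S)"
    unfolding pair[symmetric] E by (subst P.nn_integral_snd[symmetric]) auto
  also have "\<dots> = (\<integral>\<^sup>+\<omega>. \<integral>\<^sup>+x. ennreal (max 0 (c * x + S \<omega>) ^ k) \<partial>E \<partial>M)"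
    by (subst nn_integral_distr) auto
  also have "\<dots> = (\<integral>\<^sup>+\<omega>. ennreal (fact k * c ^ k * exp (S \<omega> / c)) \<partial>M)"
  proof (rule nn_integral_cong_AE)
    have "AE \<omega> in M. \<forall>j. 0 \<le> X j \<omega>"
      using AE_nonneg by (subst AE_all_countable) auto
    then show "AE \<omega> in M. (\<integral>\<^sup>+x. ennreal (max 0 (c * x + S \<omega>) ^ k) \<partial>E) = ennreal (fact k * c ^ k * exp (S \<omega> / c))"
    proof eventually_elim
      case (elim \<omega>)
      then have "S \<omega> \<le> 0"
        unfolding S_def using neg by (intro sum_nonpos) (auto intro: mult_nonpos_nonneg)
      then show ?case
        unfolding E_def by (intro nn_integral_exponential_positive_part c0 k)
    qed
  qed
  finally have I: "(\<integral>\<^sup>+\<omega>. ennreal (max 0 (lin_comb X a \<omega>) ^ k) \<partial>M)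
    = (\<integral>\<^sup>+\<omega>. ennreal (fact k * c ^ k * exp (S \<omega> / c)) \<partial>M)" .
  let ?e = "\<lambda>j \<omega>. exp (a $ j / c * X j \<omega>)"
  have T: "has_bochner_integral M (?e j) (1 / (1 - a $ j / c))" if "j \<in> UNIV - {i}" for j
    using that neg[of j] c0 by (intro exponential_transform_real exponential) (simp add: divide_nonpos_pos)
  have J: "indep_vars (\<lambda>_. borel) ?e (UNIV - {i})"
    by (rule indep_vars_subset[OF indep_vars_compose2[OF indep, where Y = "\<lambda>j x. exp (a $ j / c * x)"]]) auto
  have e: "exp (S \<omega> / c) = (\<Prod>j\<in>UNIV - {i}. ?e j \<omega>)" for \<omega>
    by (simp add: S_def sum_divide_distrib flip: exp_sum)
  have "integrable M (\<lambda>\<omega>. exp (S \<omega> / c))"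
    unfolding e by (rule indep_vars_integrable[OF _ J]) (use T in \<open>auto simp: has_bochner_integral_iff\<close>)
  then have "(\<integral>\<^sup>+\<omega>. ennreal (fact k * c ^ k * exp (S \<omega> / c)) \<partial>M)
      = ennreal (expectation (\<lambda>\<omega>. fact k * c ^ k * exp (S \<omega> / c)))"
    using c0 by (intro nn_integral_eq_integral integrable_mult_right) auto
  moreover have "expectation (\<lambda>\<omega>. exp (S \<omega> / c)) = (\<Prod>j\<in>UNIV - {i}. 1 / (1 - a $ j / c))"
    unfolding e using T by (subst indep_vars_lebesgue_integral[OF _ J]) (auto simp: has_bochner_integral_iff)
  ultimately show ?thesis
    unfolding I by (simp add: c_def)
qed

lemma abs_moment_nat:
  assumes "0 < k"
  shows "abs_moment M X (real k) a = expectation (\<lambda>\<omega>. \<bar>lin_comb X a \<omega>\<bar> ^ k)"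
  unfolding abs_moment_def using assms by (simp add: powr_realpow')

lemma abs_moment_even:
  assumes "a \<in> feasible" "even k" "0 < k"
  shows "abs_moment M X (real k) a = fact k * moment_seq (coord_prod a) k"
  using assms by (simp add: abs_moment_nat power_even_abs expectation_power)

text \<open>
  For odd \<open>k\<close>, \<open>\<bar>y\<bar>\<^sup>k = 2 (y\<^sub>+)\<^sup>k - y\<^sup>k\<close>.
\<close>

lemma abs_moment_odd:
  assumes a: "a \<in> feasible" and p: "0 \<le> coord_prod a" and k: "odd k"
    and i: "0 < a $ i" "\<And>j. j \<noteq> i \<Longrightarrow> a $ j \<le> 0"
  shows "abs_moment M X (real k) a = fact k * signed_seq (a $ i) k"
proof -
  let ?c = "a $ i"
  have k0: "0 < k" using k by (cases k) auto
  have abs: "\<bar>y\<bar> ^ k = 2 * max 0 y ^ k - y ^ k" for y :: real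
    using k k0 by (cases "0 \<le> y") (auto simp: power_minus_odd max_def)
  have int: "integrable M (\<lambda>\<omega>. max 0 (lin_comb X a \<omega>) ^ k)"
    by (rule Bochner_Integration.integrable_bound[OF integrable_power[of a k]])
       (auto simp: power_abs max_def intro!: AE_I2 power_mono)
  have "ennreal (expectation (\<lambda>\<omega>. max 0 (lin_comb X a \<omega>) ^ k))
     = (\<integral>\<^sup>+\<omega>. ennreal (max 0 (lin_comb X a \<omega>) ^ k) \<partial>M)"
    using int by (intro nn_integral_eq_integral[symmetric]) auto
  also have "\<dots> = ennreal (fact k * ?c ^ k * (?c\<^sup>2 / (3 * ?c\<^sup>2 - 1 / 2)))"
    using nn_integral_positive_part[OF i k0] feasible_root(2)[OF a i(1)] by simp
  finally have "expectation (\<lambda>\<omega>. max 0 (lin_comb X a \<omega>) ^ k) = fact k * ?c ^ k * (?c\<^sup>2 / (3 * ?c\<^sup>2 - 1 / 2))"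
  proof (subst (asm) ennreal_inj)
    show "0 \<le> fact k * ?c ^ k * (?c\<^sup>2 / (3 * ?c\<^sup>2 - 1 / 2))"
      using feasible_coord_bounds(1)[OF a p i(1)] i(1) by simp
  qed (auto intro: Bochner_Integration.integral_nonneg)
  moreover have "fact k * ?c ^ k * (?c\<^sup>2 / (3 * ?c\<^sup>2 - 1 / 2)) = fact k * (?c ^ (k + 2) / (3 * ?c\<^sup>2 - 1 / 2))"
    by (simp add: power_add power2_eq_square)
  moreover have "expectation (\<lambda>\<omega>. \<bar>lin_comb X a \<omega>\<bar> ^ k)
      = 2 * expectation (\<lambda>\<omega>. max 0 (lin_comb X a \<omega>) ^ k) - expectation (\<lambda>\<omega>. lin_comb X a \<omega> ^ k)"
    unfolding abs using int integrable_power[of a k] by simp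
  ultimately show ?thesis
    unfolding abs_moment_nat[OF k0] expectation_power[OF a] signed_seq_def feasible_root(1)[OF a]
    by (simp add: right_diff_distrib)
qed

lemma abs_moment_orient:
  assumes a: "a \<in> feasible"
  shows "\<exists>a'\<in>feasible. coord_prod a' = \<bar>coord_prod a\<bar> \<and> (\<forall>q. abs_moment M X q a' = abs_moment M X q a)"
proof (cases "0 \<le> coord_prod a")
  case True
  then show ?thesis using a by (intro bexI[of _ a]) auto
next
  case False
  have "lin_comb X (- a) \<omega> = - lin_comb X a \<omega>" for \<omega>
    by (simp add: lin_comb_def)
  then have "abs_moment M X q (- a) = abs_moment M X q a" for q
    by (simp add: abs_moment_def)
  moreover have "- a \<in> feasible" using a by (simp add: feasible_def)
  ultimately show ?thesis using False by (intro bexI[of _ "- a"]) (auto simp: coord_prod_def)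
qed

text \<open>
  After orientation both products are nonnegative.  For odd \<open>k\<close> the comparison passes from products to
  positive coordinates, as \<open>c (c\<^sup>2 - 1/2)\<close> is strictly increasing in \<open>c\<close> for \<open>c\<^sup>2 \<ge> 1/2\<close>.
\<close>

lemma abs_moment_nat_mono:
  assumes "a \<in> feasible" "b \<in> feasible" "(coord_prod a)\<^sup>2 \<le> (coord_prod b)\<^sup>2" and k: "3 < k"
  shows "abs_moment M X (real k) a \<le> abs_moment M X (real k) b"
proof -
  have *: "abs_moment M X (real k) a \<le> abs_moment M X (real k) b"
    if ab: "a \<in> feasible" "b \<in> feasible" and p: "0 \<le> coord_prod a" "coord_prod a \<le> coord_prod b" for a b
  proof (cases "even k")
    case True
    then show ?thesis using ab p k moment_seq_mono[OF p, of k] by (simp add: abs_moment_even)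
  next
    case False
    have pb: "0 \<le> coord_prod b" using p by simp
    obtain i where i: "0 < a $ i" "\<And>j. j \<noteq> i \<Longrightarrow> a $ j \<le> 0"
      using feasible_single_positive[OF ab(1) p(1)] by blast
    obtain l where l: "0 < b $ l" "\<And>j. j \<noteq> l \<Longrightarrow> b $ j \<le> 0"
      using feasible_single_positive[OF ab(2) pb] by blast
    note bi = feasible_coord_bounds[OF ab(1) p(1) i(1)] and bl = feasible_coord_bounds[OF ab(2) pb l(1)]
    have le: "a $ i \<le> b $ l"
    proof (rule ccontr)
      assume "\<not> a $ i \<le> b $ l"
      then have "b $ l < a $ i" by simp
      moreover have "(b $ l)\<^sup>2 < (a $ i)\<^sup>2" using l(1) \<open>b $ l < a $ i\<close> by (intro power_strict_mono) auto
      ultimately have "b $ l * ((b $ l)\<^sup>2 - 1 / 2) < a $ i * ((a $ i)\<^sup>2 - 1 / 2)"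
        using l(1) bl by (intro mult_strict_mono) auto
      then show False using p by (simp add: feasible_root(1)[OF ab(1)] feasible_root(1)[OF ab(2)])
    qed
    have five: "abs_moment M X 5 c = 120 * signed_seq (c $ j) 5"
      if "c \<in> feasible" "0 \<le> coord_prod c" "0 < c $ j" "\<And>n. n \<noteq> j \<Longrightarrow> c $ n \<le> 0" for c j
      using abs_moment_odd[OF that(1,2) _ that(3,4), of 5] by (simp add: fact_numeral)
    \<comment> \<open>\<open>5 = 2 * 3 - 2 * (1/2)\<close> lies in the fractional range with \<open>m = 3\<close>.\<close>
    have "abs_moment M X 5 a \<le> abs_moment M X 5 b"
      using abs_moment_mono[of a b 3 "1 / 2"] ab p by simp
    moreover have "0 \<le> abs_moment M X 5 a"
      unfolding abs_moment_def by (rule Bochner_Integration.integral_nonneg) simp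
    ultimately have "0 \<le> signed_seq (a $ i) 5" "signed_seq (a $ i) 5 \<le> signed_seq (b $ l) 5"
      using five[OF ab(1) p(1) i] five[OF ab(2) pb l] by auto
    then have "signed_seq (a $ i) (k - 4 + 4) \<le> signed_seq (b $ l) (k - 4 + 4)"
      using signed_seq_mono[OF i(1) bi(1) le bl(2)] by blast
    then show ?thesis
      using k by (simp add: abs_moment_odd[OF ab(1) p(1) False i] abs_moment_odd[OF ab(2) pb False l])
  qed
  obtain a' where a': "a' \<in> feasible" "coord_prod a' = \<bar>coord_prod a\<bar>" "\<And>q. abs_moment M X q a' = abs_moment M X q a"
    using abs_moment_orient[OF assms(1)] by blast
  obtain b' where b': "b' \<in> feasible" "coord_prod b' = \<bar>coord_prod b\<bar>" "\<And>q. abs_moment M X q b' = abs_moment M X q b"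
    using abs_moment_orient[OF assms(2)] by blast
  show ?thesis
    using *[OF a'(1) b'(1)] assms(3) a'(2,3) b'(2,3) by (simp add: abs_le_square_iff)
qed

end

section \<open>The extremal points\<close>

theorem proposition5p3:
  fixes M :: "'w measure" and X :: "3 \<Rightarrow> 'w \<Rightarrow> real"
  assumes "prob_space M"
    and "prob_space.indep_vars M (\<lambda>_. borel) X UNIV"
    and "\<And>i. distributed M lborel (X i) (exponential_density 1)"
  shows "(\<forall>q>-1. \<forall>a\<in>feasible. integrable M (\<lambda>\<omega>. \<bar>lin_comb X a \<omega>\<bar> powr q)) \<and>
    (\<forall>q\<in>{-1<..<0} \<union> {2<..<4}.
       minimized_at (abs_moment M X q) x1 \<and> maximized_at (abs_moment M X q) x2) \<and>
    (\<forall>q\<in>{0<..<2} \<union> {4<..<6}.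
       minimized_at (abs_moment M X q) x2 \<and> maximized_at (abs_moment M X q) x1) \<and>
    (\<forall>k::nat. k > 3 \<longrightarrow>
       minimized_at (abs_moment M X (real k)) x2 \<and> maximized_at (abs_moment M X (real k)) x1) \<and>
    (\<forall>q\<in>{2, 4}. (abs_moment M X q) constant_on feasible)"
proof -
  interpret iid_exponential_triple M X
    using assms by (simp add: iid_exponential_triple_def iid_exponential_triple_axioms_def)
  have window: "\<exists>\<kappa>. q = 2 * real m - 2 * \<kappa> \<and> 0 < \<kappa> \<and> \<kappa> < 1" if "2 * real m - 2 < q" "q < 2 * real m" for q m
    using that by (intro exI[of _ "real m - q / 2"]) auto
  have anti: "abs_moment M X q b \<le> abs_moment M X q a"
    if ab: "a \<in> feasible" "b \<in> feasible" "(coord_prod a)\<^sup>2 \<le> (coord_prod b)\<^sup>2"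
      and q: "q \<in> {-1<..<0} \<union> {2<..<4}" for a b q
  proof -
    define m :: nat where "m = (if q < 0 then 0 else 2)"
    obtain \<kappa> where "q = 2 * real m - 2 * \<kappa>" "0 < \<kappa>" "\<kappa> < 1"
      using window[of m q] q by (auto simp: m_def split: if_splits)
    then show ?thesis using abs_moment_mono[OF ab, of m \<kappa>] q by (auto simp: m_def split: if_splits)
  qed
  have mono: "abs_moment M X q a \<le> abs_moment M X q b"
    if ab: "a \<in> feasible" "b \<in> feasible" "(coord_prod a)\<^sup>2 \<le> (coord_prod b)\<^sup>2"
      and q: "q \<in> {0<..<2} \<union> {4<..<6}" for a b q
  proof -
    define m :: nat where "m = (if q < 2 then 1 else 3)"
    obtain \<kappa> where "q = 2 * real m - 2 * \<kappa>" "0 < \<kappa>" "\<kappa> < 1"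
      using window[of m q] q by (auto simp: m_def split: if_splits)
    then show ?thesis using abs_moment_mono[OF ab, of m \<kappa>] q by (auto simp: m_def split: if_splits)
  qed
  have seq: "moment_seq p 2 = 1 / 2" "moment_seq p 4 = 1 / 4" for p
    by (simp_all add: numeral_eq_Suc)
  have "abs_moment M X 2 a = 1 \<and> abs_moment M X 4 a = 6" if "a \<in> feasible" for a
    using abs_moment_even[OF that, of 2] abs_moment_even[OF that, of 4]
    unfolding seq by (simp add: fact_numeral)
  then have const: "abs_moment M X 2 constant_on feasible" "abs_moment M X 4 constant_on feasible"
    by (auto simp: constant_on_def)
  show ?thesis
  proof (intro conjI allI ballI impI)
    show "integrable M (\<lambda>\<omega>. \<bar>lin_comb X a \<omega>\<bar> powr q)" if "- 1 < q" "a \<in> feasible" for q a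
      using integrable_abs_powr that by blast
  next
    fix q :: real assume "q \<in> {-1<..<0} \<union> {2<..<4}"
    then have "minimized_at (abs_moment M X q) x1 \<and> maximized_at (abs_moment M X q) x2"
      by (intro extremal_of_antimono anti)
    then show "minimized_at (abs_moment M X q) x1" "maximized_at (abs_moment M X q) x2" by simp_all
  next
    fix q :: real assume "q \<in> {0<..<2} \<union> {4<..<6}"
    then have "minimized_at (abs_moment M X q) x2 \<and> maximized_at (abs_moment M X q) x1"
      by (intro extremal_of_mono mono)
    then show "minimized_at (abs_moment M X q) x2" "maximized_at (abs_moment M X q) x1" by simp_all
  next
    fix k :: nat assume "3 < k"
    then have "minimized_at (abs_moment M X (real k)) x2 \<and> maximized_at (abs_moment M X (real k)) x1"
      by (intro extremal_of_mono abs_moment_nat_mono)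
    then show "minimized_at (abs_moment M X (real k)) x2" "maximized_at (abs_moment M X (real k)) x1"
      by simp_all
  next
    show "abs_moment M X q constant_on feasible" if "q \<in> {2, 4}" for q
      using const that by auto
  qed
qed

end
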